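(* Let $K\subseteq E$ be a symmetric cone, and let $F:\operatorname{int}(K)\to\mathbb{R}$ be a self-scaled barrier function. If $H\in\operatorname{Aut}(K)_0$ is orthogonal, then $F(Hx)=F(x)$ for all $x\in\operatorname{int}(K)$.
   Context: Cones. A cone $K$ in a finite-dimensional Euclidean space $(E,\langle\cdot,\cdot\rangle)$ is regular if it is closed, convex, pointed (contains no line) and solid (non-empty interior). Its dual cone is $K^*=\{s\in E:\langle x,s\rangle\ge 0\ \forall x\in K\}$. $\operatorname{Aut}(K)=\{A\in \mathrm{GL}(E):A(K)=K\}$, and $\operatorname{Aut}(K)_0$ is the connected component of the identity in $\operatorname{Aut}(K)$. A regular cone $K$ is symmetric (homogeneous self-dual) if $\operatorname{Aut}(K)$ acts transitively on $\operatorname{int}(K)$ and $E$ can be endowed with an inner product for which $K^*=K$. Self-scaled barriers. A function $F:\operatorname{int}(K)\to\mathbb{R}$ is a self-concordant barrier if it is $C^3$, convex, $F(x_k)\to\infty$ whenever $x_k\in\operatorname{int}(K)$ converges to a boundary point of $K$, $|D^3F(x)[h,h,h]|\le 2\,(D^2F(x)[h,h])^{3/2}$ for all $x\in\operatorname{int}(K)$, $h\in E$, and $|DF(x)[h]|^2\le\nu\, D^2F(x)[h,h]$ for some constant $\nu$. The Hessian $F''(x)$ is the symmetric operator with $\langle F''(x)u,v\rangle=D^2F(x)[u,v]$. A self-concordant barrier $F$ is self-scaled if $F''(x)$ is non-singular for all $x\in\operatorname{int}(K)$, there is $\nu>0$ with $F(tx)=F(x)-\nu\ln t$ for all $x\in\operatorname{int}(K)$,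 $t>0$, and for all $x,w\in\operatorname{int}(K)$: $F''(w)x\in\operatorname{int}(K^* )$ and $F_*(F''(w)x)=F(x)-2F(w)-\nu$, where $F_*(s)=\sup\{-\langle x,s\rangle-F(x):x\in\operatorname{int}(K)\}$ for $s\in\operatorname{int}(K^* )$. Standing convention. The inner product $\langle\cdot,\cdot\rangle$ on $E$ is such that $K^*=K$ and there is a (unique) point $e\in\operatorname{int}(K)$ with $F''(e)=I$ (the identity operator). Orthogonality of $H$ refers to this inner product. *)

theory Defs
  imports "HOL-Analysis.Analysis"
begin

definition regular_cone :: "'a::euclidean_space set \<Rightarrow> bool" where
  "regular_cone K \<longleftrightarrow> cone K \<and> closed K \<and> convex K
     \<and> \<not> (\<exists>x d. d \<noteq> 0 \<and> (\<forall>t::real. x + t *\<^sub>R d \<in> K))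
     \<and> interior K \<noteq> {}"

definition is_inner_product :: "('a::euclidean_space \<Rightarrow> 'a \<Rightarrow> real) \<Rightarrow> bool" where
  "is_inner_product B \<longleftrightarrow> bilinear B \<and> (\<forall>x y. B x y = B y x) \<and> (\<forall>x. x \<noteq> 0 \<longrightarrow> B x x > 0)"

definition dual_cone_wrt :: "('a::euclidean_space \<Rightarrow> 'a \<Rightarrow> real) \<Rightarrow> 'a set \<Rightarrow> 'a set" where
  "dual_cone_wrt B K = {s. \<forall>x\<in>K. B x s \<ge> 0}"

abbreviation dual_cone :: "'a::euclidean_space set \<Rightarrow> 'a set" where
  "dual_cone K \<equiv> dual_cone_wrt (\<bullet>) K"

text \<open>Automorphisms are bounded linear maps, so that the automorphism group carries the
  topology of the operator norm, which is the usual topology on the general linear group.\<close>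

definition Aut_cone :: "'a::euclidean_space set \<Rightarrow> ('a \<Rightarrow>\<^sub>L 'a) set" where
  "Aut_cone K = {A. bij (blinfun_apply A) \<and> blinfun_apply A ` K = K}"

definition Aut_cone0 :: "'a::euclidean_space set \<Rightarrow> ('a \<Rightarrow>\<^sub>L 'a) set" where
  "Aut_cone0 K = connected_component_set (Aut_cone K) id_blinfun"

text \<open>Self-duality only has to hold for some inner product on the space, not
  necessarily for the one of the type class.\<close>

definition symmetric_cone :: "'a::euclidean_space set \<Rightarrow> bool" where
  "symmetric_cone K \<longleftrightarrow> regular_cone K
     \<and> (\<forall>x\<in>interior K. \<forall>y\<in>interior K. \<exists>A\<in>Aut_cone K. blinfun_apply A x = y)
     \<and> (\<exists>B. is_inner_product B \<and> dual_cone_wrt B K = K)"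

text \<open>The Frechet derivative as a bounded linear map; iterating it gives higher derivatives as
  nested bounded linear maps. It is only meaningful where the function is differentiable.\<close>

definition fderiv :: "('a::euclidean_space \<Rightarrow> 'b::real_normed_vector) \<Rightarrow> 'a \<Rightarrow> 'a \<Rightarrow>\<^sub>L 'b" where
  "fderiv f x = Blinfun (frechet_derivative f (at x))"

lemma fderiv_has_derivative:
  assumes "f differentiable (at x)"
  shows "(f has_derivative blinfun_apply (fderiv f x)) (at x)"
proof -
  have d: "(f has_derivative frechet_derivative f (at x)) (at x)"
    using assms by (simp add: frechet_derivative_works)
  then have "blinfun_apply (fderiv f x) = frechet_derivative f (at x)"
    unfolding fderiv_def by (intro bounded_linear_Blinfun_apply has_derivative_bounded_linear)
  with d show ?thesis by simp
qed

definition D1 :: "('a::euclidean_space \<Rightarrow> real) \<Rightarrow> 'a \<Rightarrow> 'a \<Rightarrow> real" where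
  "D1 F x h = blinfun_apply (fderiv F x) h"

definition D2 :: "('a::euclidean_space \<Rightarrow> real) \<Rightarrow> 'a \<Rightarrow> 'a \<Rightarrow> 'a \<Rightarrow> real" where
  "D2 F x u v = blinfun_apply (blinfun_apply (fderiv (fderiv F) x) u) v"

definition D3 :: "('a::euclidean_space \<Rightarrow> real) \<Rightarrow> 'a \<Rightarrow> 'a \<Rightarrow> 'a \<Rightarrow> 'a \<Rightarrow> real" where
  "D3 F x u v w =
     blinfun_apply (blinfun_apply (blinfun_apply (fderiv (fderiv (fderiv F)) x) u) v) w"

text \<open>Only used for open \<open>S\<close>, where the derivative within \<open>S\<close> is the full derivative.\<close>

definition C3_on :: "'a::euclidean_space set \<Rightarrow> ('a \<Rightarrow> real) \<Rightarrow> bool" where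
  "C3_on S F \<longleftrightarrow>
     (\<forall>x\<in>S. F differentiable (at x) \<and> fderiv F differentiable (at x)
            \<and> fderiv (fderiv F) differentiable (at x))
     \<and> continuous_on S (fderiv (fderiv (fderiv F)))"

text \<open>The operator representing the second derivative through the inner product, written out in
  coordinates; see the following lemma for the defining property.\<close>

definition hess :: "('a::euclidean_space \<Rightarrow> real) \<Rightarrow> 'a \<Rightarrow> 'a \<Rightarrow> 'a" where
  "hess F x u = (\<Sum>b\<in>Basis. D2 F x u b *\<^sub>R b)"

lemma hess_inner: "hess F x u \<bullet> v = D2 F x u v"
proof -
  have "D2 F x u v = D2 F x u (\<Sum>b\<in>Basis. (v \<bullet> b) *\<^sub>R b)"
    by (simp add: euclidean_representation)
  also have "\<dots> = (\<Sum>b\<in>Basis. (v \<bullet> b) * D2 F x u b)"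
    unfolding D2_def by (simp add: blinfun.sum_right blinfun.scaleR_right)
  finally show ?thesis
    by (simp add: hess_def inner_sum_right inner_commute[of _ v] mult.commute[of "D2 F x u _"])
qed

text \<open>The barrier \<open>F\<close> is a total function, but only its values on the interior of \<open>K\<close>
  matter below.\<close>

definition self_concordant_barrier :: "'a::euclidean_space set \<Rightarrow> ('a \<Rightarrow> real) \<Rightarrow> bool" where
  "self_concordant_barrier K F \<longleftrightarrow>
     C3_on (interior K) F \<and> convex_on (interior K) F
     \<and> (\<forall>X z. (\<forall>k::nat. X k \<in> interior K) \<longrightarrow> z \<in> frontier K \<longrightarrow> X \<longlonglongrightarrow> z
           \<longrightarrow> filterlim (\<lambda>k. F (X k)) at_top sequentially)
     \<and> (\<forall>x\<in>interior K. \<forall>h. \<bar>D3 F x h h h\<bar> \<le> 2 * (D2 F x h h) powr (3/2))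
     \<and> (\<exists>\<nu>::real. \<forall>x\<in>interior K. \<forall>h. \<bar>D1 F x h\<bar>\<^sup>2 \<le> \<nu> * D2 F x h h)"

text \<open>The conjugate takes values in the extended reals so that an infinite
  supremum is not confused with a real number.\<close>

definition conj_barrier :: "'a::euclidean_space set \<Rightarrow> ('a \<Rightarrow> real) \<Rightarrow> 'a \<Rightarrow> ereal" where
  "conj_barrier K F s = (SUP x\<in>interior K. ereal (- (x \<bullet> s) - F x))"

definition self_scaled_barrier :: "'a::euclidean_space set \<Rightarrow> ('a \<Rightarrow> real) \<Rightarrow> bool" where
  "self_scaled_barrier K F \<longleftrightarrow>
     self_concordant_barrier K F
     \<and> (\<forall>x\<in>interior K. bij (hess F x))
     \<and> (\<exists>\<nu>>0.
          (\<forall>x\<in>interior K. \<forall>t>0. F (t *\<^sub>R x) = F x - \<nu> * ln t)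
          \<and> (\<forall>x\<in>interior K. \<forall>w\<in>interior K.
               hess F w x \<in> interior (dual_cone K)
               \<and> conj_barrier K F (hess F w x) = ereal (F x - 2 * F w - \<nu>)))"

end

theory Submission
  imports Defs
begin

text \<open>Write \<open>P x\<close> for the Hessian of \<open>F\<close> at \<open>x\<close>, call a self-adjoint positive definite
automorphism of \<open>K\<close> a positive automorphism, and let \<open>H\<close> be orthogonal in the identity
component of the automorphism group. The idea is to show that \<open>F \<circ> H\<close> and \<open>F\<close> have the same
Hessian. All of it is done with Hessians and the group, without Jordan algebras and
without splitting \<open>K\<close> into irreducible cones.

\<^emph>\<open>Rigidity.\<close> Because \<open>P e\<close> is the identity, the duality between \<open>F\<close> and its conjugate turns into
\<open>F (P w x) = F x - 2 F w + 2 F e\<close>. Every \<open>P w\<close> is a positive automorphism. For all interior \<open>x\<close>, \<open>s\<close> some \<open>w\<close>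
satisfies \<open>P w x = s\<close>: minimize \<open>s \<bullet> w - g w \<bullet> x\<close> over \<open>w\<close>, where \<open>g\<close> is the gradient
(\<open>scaling_point_exists\<close>). A positive automorphism is determined by its value at one interior point
(\<open>positive_automorphism_unique\<close>), hence the positive automorphisms are exactly the operators \<open>P w\<close>,
and \<open>F\<close> is invariant under each of them up to a constant.

\<^emph>\<open>Invariant functions.\<close> \<open>F \<circ> H\<close> has the same homogeneity and the same invariance. For any
such function the symmetry of third derivatives forces its Hessian to be \<open>P x \<circ> S\<close>, with one operator
\<open>S\<close> that commutes with all \<open>P x\<close> (\<open>invariant_function_hessian\<close>). On a product of
irreducible cones, \<open>S\<close> multiplies each factor by a weight, and an orthogonal automorphism can
really permute these weights; this is why connectedness is needed.

\<^emph>\<open>Connectedness.\<close> The operators commuting with all \<open>P x\<close> are self-adjoint and commute with each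
other, and conjugation by an automorphism \<open>A\<close> of \<open>K\<close> maps this algebra to itself. So the inverse
of \<open>A\<close>, composed with \<open>S \<circ> A\<close>, is self-adjoint, commutes with \<open>S\<close> and has the spectrum of \<open>S\<close>. Such
operators are isolated from each other, so the conjugate does not change on the identity component, and
\<open>H\<close> commutes with \<open>S\<close> (\<open>commutes_on_identity_component\<close>).

\<^emph>\<open>Compactness.\<close> Composing \<open>n\<close> times gives \<open>F \<circ> H\<^sup>n\<close> the Hessian \<open>P x \<circ> S\<^sup>n\<close>. The orbit of \<open>e\<close> under the isometry
\<open>H\<close> stays in a compact subset of the interior, so all powers of \<open>S\<close> and of its inverse are
bounded, and the positive operator \<open>S\<close> is the identity. Then \<open>F \<circ> H - F\<close> is a
constant \<open>c\<close>, and \<open>c = 0\<close> because \<open>F e + n c\<close> stays bounded.\<close>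


section \<open>Derivatives up to third order\<close>

lemma blinfun_linear: "linear (blinfun_apply A)"
  by (simp add: blinfun.bounded_linear_right bounded_linear.linear)

lemma blinfun_adjoint_exists:
  fixes A :: "'a::euclidean_space \<Rightarrow>\<^sub>L 'a"
  shows "\<exists>B :: 'a \<Rightarrow>\<^sub>L 'a. \<forall>x y. A x \<bullet> y = x \<bullet> B y"
proof (intro exI allI)
  note lin = blinfun_linear[of A]
  have "bounded_linear (adjoint (blinfun_apply A))"
    using adjoint_linear[OF lin] linear_conv_bounded_linear by blast
  then show "A x \<bullet> y = x \<bullet> Blinfun (adjoint (blinfun_apply A)) y" for x y
    by (simp add: bounded_linear_Blinfun_apply adjoint_works[OF lin])
qed

lemma blinfun_inverse_exists:
  fixes A :: "'a::euclidean_space \<Rightarrow>\<^sub>L 'a"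
  assumes "bij (blinfun_apply A)"
  shows "\<exists>B :: 'a \<Rightarrow>\<^sub>L 'a. (\<forall>x. B (A x) = x) \<and> (\<forall>x. A (B x) = x)"
proof (intro exI conjI allI)
  note lin = blinfun_linear[of A]
  have "linear (inv (blinfun_apply A))"
    using lin assms bij_is_inj inj_linear_imp_inv_linear by blast
  then have bl: "bounded_linear (inv (blinfun_apply A))"
    using linear_conv_bounded_linear by blast
  show "Blinfun (inv (blinfun_apply A)) (A x) = x" for x
    using assms bl by (simp add: bounded_linear_Blinfun_apply bij_is_inj)
  show "A (Blinfun (inv (blinfun_apply A)) x) = x" for x
    using assms bl by (simp add: bounded_linear_Blinfun_apply bij_is_surj surj_f_inv_f)
qed

text \<open>Gradient, Hessian and third derivative are carried as explicit witnesses, the first two identified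
with a vector and an operator through the inner product. Unlike nested derivative operators,
such witnesses transform by a plain formula under a linear change of variables.\<close>

definition third_order_jet ::
  "'a::euclidean_space set \<Rightarrow> ('a \<Rightarrow> real) \<Rightarrow> ('a \<Rightarrow> 'a) \<Rightarrow> ('a \<Rightarrow> 'a \<Rightarrow>\<^sub>L 'a)
    \<Rightarrow> ('a \<Rightarrow> 'a \<Rightarrow>\<^sub>L 'a \<Rightarrow>\<^sub>L 'a) \<Rightarrow> bool" where
  "third_order_jet S f g P Q \<longleftrightarrow> open S \<and>
     (\<forall>x\<in>S. (f has_derivative (\<lambda>h. g x \<bullet> h)) (at x)
          \<and> (g has_derivative blinfun_apply (P x)) (at x)
          \<and> (P has_derivative blinfun_apply (Q x)) (at x))"

lemma third_order_jetD:
  assumes "third_order_jet S f g P Q"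
  shows "open S"
    and "x \<in> S \<Longrightarrow> (f has_derivative (\<lambda>h. g x \<bullet> h)) (at x)"
    and "x \<in> S \<Longrightarrow> (g has_derivative blinfun_apply (P x)) (at x)"
    and "x \<in> S \<Longrightarrow> (P has_derivative blinfun_apply (Q x)) (at x)"
  using assms by (auto simp: third_order_jet_def)

lemma has_derivative_eq_on_open:
  assumes "open S" "x \<in> S" "(f has_derivative f') (at x)" "(g has_derivative g') (at x)"
    and "\<And>y. y \<in> S \<Longrightarrow> f y = g y"
  shows "f' = g'"
proof -
  have "(g has_derivative f') (at x)"
    using has_derivative_transform_within_open[OF assms(3,1,2)] assms(5) by blast
  then show ?thesis using assms(4) has_derivative_unique by blast
qed

text \<open>Comparing derivatives of the two sides of an identity such as \<open>F (T x) = F x + c\<close>.\<close>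

lemma third_order_jet_unique:
  assumes f: "third_order_jet S f g P Q" and f': "third_order_jet S f' g' P' Q'"
    and eq: "\<And>x. x \<in> S \<Longrightarrow> f' x = f x + c"
    and x: "x \<in> S"
  shows "g' x = g x" "P' x = P x" "Q' x = Q x"
proof -
  have g: "g' y = g y" if y: "y \<in> S" for y
  proof -
    have "((\<lambda>z. f z + c) has_derivative (\<lambda>h. g y \<bullet> h)) (at y)"
      using third_order_jetD(2)[OF f y] by (auto intro!: derivative_eq_intros)
    from has_derivative_eq_on_open[OF third_order_jetD(1)[OF f] y third_order_jetD(2)[OF f' y] this]
    have "(\<lambda>h. g' y \<bullet> h) = (\<lambda>h. g y \<bullet> h)" using eq by blast
    then show ?thesis by (metis vector_eq_rdot)
  qed
  have P: "P' y = P y" if y: "y \<in> S" for y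
    using has_derivative_eq_on_open[OF third_order_jetD(1)[OF f] y
        third_order_jetD(3)[OF f' y] third_order_jetD(3)[OF f y] g]
    by (simp add: blinfun_apply_inject)
  have Q: "Q' y = Q y" if y: "y \<in> S" for y
    using has_derivative_eq_on_open[OF third_order_jetD(1)[OF f] y
        third_order_jetD(4)[OF f' y] third_order_jetD(4)[OF f y] P]
    by (simp add: blinfun_apply_inject)
  show "g' x = g x" "P' x = P x" "Q' x = Q x" using g P Q x by auto
qed

lemma third_order_jet_compose_linear:
  assumes f: "third_order_jet S f g P Q"
    and AS: "\<And>x. x \<in> S \<Longrightarrow> blinfun_apply A x \<in> S"
    and B: "\<And>x y. A x \<bullet> y = x \<bullet> blinfun_apply B y"
  obtains Q' where "third_order_jet S (\<lambda>x. f (A x)) (\<lambda>x. B (g (A x)))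
      (\<lambda>x. B o\<^sub>L P (A x) o\<^sub>L A) Q'"
proof
  have bl: "bounded_linear (\<lambda>T. B o\<^sub>L T o\<^sub>L A)"
    by (intro bounded_linear_intros)
  define C where "C = Blinfun (\<lambda>T. B o\<^sub>L T o\<^sub>L A)"
  have C: "blinfun_apply C = (\<lambda>T. B o\<^sub>L T o\<^sub>L A)"
    unfolding C_def by (rule bounded_linear_Blinfun_apply[OF bl])
  define Q' where "Q' x = C o\<^sub>L (Q (A x)) o\<^sub>L A" for x
  have dA: "(blinfun_apply A has_derivative blinfun_apply A) (at x)" for x
    using bounded_linear.has_derivative[OF blinfun.bounded_linear_right has_derivative_ident] .
  show "third_order_jet S (\<lambda>x. f (A x)) (\<lambda>x. B (g (A x))) (\<lambda>x. B o\<^sub>L P (A x) o\<^sub>L A) Q'"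
    unfolding third_order_jet_def
  proof (intro conjI ballI)
    show "open S" by (rule third_order_jetD(1)[OF f])
    fix x assume x: "x \<in> S"
    have "((\<lambda>x. f (A x)) has_derivative (\<lambda>h. g (A x) \<bullet> A h)) (at x)"
      using has_derivative_compose[OF dA third_order_jetD(2)[OF f AS[OF x]]] .
    then show "((\<lambda>x. f (A x)) has_derivative (\<lambda>h. B (g (A x)) \<bullet> h)) (at x)"
      using B by (simp add: inner_commute)
    have "((\<lambda>x. g (A x)) has_derivative (\<lambda>h. P (A x) (A h))) (at x)"
      using has_derivative_compose[OF dA third_order_jetD(3)[OF f AS[OF x]]] .
    then have "((\<lambda>x. B (g (A x))) has_derivative (\<lambda>h. B (P (A x) (A h)))) (at x)"
      by (rule bounded_linear.has_derivative[OF blinfun.bounded_linear_right])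
    then show "((\<lambda>x. B (g (A x))) has_derivative blinfun_apply (B o\<^sub>L P (A x) o\<^sub>L A)) (at x)"
      by (simp add: o_def blinfun_compose.rep_eq)
    have "((\<lambda>x. P (A x)) has_derivative (\<lambda>h. Q (A x) (A h))) (at x)"
      using has_derivative_compose[OF dA third_order_jetD(4)[OF f AS[OF x]]] .
    then have "((\<lambda>x. B o\<^sub>L P (A x) o\<^sub>L A) has_derivative (\<lambda>h. B o\<^sub>L Q (A x) (A h) o\<^sub>L A)) (at x)"
      by (rule bounded_linear.has_derivative[OF bl])
    then show "((\<lambda>x. B o\<^sub>L P (A x) o\<^sub>L A) has_derivative blinfun_apply (Q' x)) (at x)"
      by (simp add: Q'_def C o_def blinfun_compose.rep_eq)
  qed
qed

text \<open>By the mean value theorem applied in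
direction \<open>u\<close>, the second difference of \<open>f\<close> along \<open>t u\<close> and \<open>t v\<close> is \<open>t\<^sup>2 (L v \<bullet> u)\<close> up to \<open>o(t\<^sup>2)\<close>;
the second difference is symmetric in \<open>u\<close> and \<open>v\<close>.\<close>

lemma derivative_of_gradient_symmetric:
  fixes g :: "'a::euclidean_space \<Rightarrow> 'a"
  assumes S: "open S" "x \<in> S"
    and f: "\<And>y. y \<in> S \<Longrightarrow> (f has_derivative (\<lambda>h. g y \<bullet> h)) (at y)"
    and g: "(g has_derivative L) (at x)"
  shows "L u \<bullet> v = L v \<bullet> u"
proof -
  have lin: "linear L" using g has_derivative_linear by blast
  obtain r where r: "r > 0" "ball x r \<subseteq> S" using S openE by blast
  have diff: "\<exists>t0>0. \<forall>t. 0 < t \<and> t < t0 \<longrightarrow>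
      \<bar>(f (x + t *\<^sub>R u + t *\<^sub>R v) - f (x + t *\<^sub>R u) - f (x + t *\<^sub>R v) + f x) - t\<^sup>2 * (L v \<bullet> u)\<bar>
        \<le> \<epsilon> * t\<^sup>2 * (2 * norm u + norm v) * norm u"
    if eps: "\<epsilon> > 0" for \<epsilon> u v
  proof -
    obtain d where d: "d > 0" "\<And>y. norm (y - x) < d \<Longrightarrow> norm (g y - g x - L (y - x)) \<le> \<epsilon> * norm (y - x)"
      using g eps unfolding has_derivative_at_alt by blast
    define M where "M = norm u + norm v + 1"
    have M: "M > 0" unfolding M_def by (simp add: add_nonneg_pos)
    define t0 where "t0 = min d r / M"
    have "t0 > 0" using d r M by (simp add: t0_def)
    moreover have "\<bar>(f (x + t *\<^sub>R u + t *\<^sub>R v) - f (x + t *\<^sub>R u) - f (x + t *\<^sub>R v) + f x) - t\<^sup>2 * (L v \<bullet> u)\<bar>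
        \<le> \<epsilon> * t\<^sup>2 * (2 * norm u + norm v) * norm u" if t: "0 < t" "t < t0" for t
    proof -
      have tM: "t * M < d" "t * M < r"
        using t M by (auto simp: t0_def field_simps)
      have small: "norm (s *\<^sub>R u + s' *\<^sub>R v) < d \<and> norm (s *\<^sub>R u + s' *\<^sub>R v) < r"
        if "0 \<le> s" "s \<le> t" "0 \<le> s'" "s' \<le> t" for s s'
      proof -
        have "norm (s *\<^sub>R u + s' *\<^sub>R v) \<le> s * norm u + s' * norm v"
          using norm_triangle_ineq[of "s *\<^sub>R u" "s' *\<^sub>R v"] that by simp
        also have "\<dots> \<le> t * norm u + t * norm v"
          using that by (intro add_mono mult_right_mono) auto
        also have "\<dots> \<le> t * M" using t by (simp add: M_def algebra_simps)
        finally show ?thesis using tM by linarith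
      qed
      have inS: "x + s *\<^sub>R u + s' *\<^sub>R v \<in> S"
        if "0 \<le> s" "s \<le> t" "0 \<le> s'" "s' \<le> t" for s s'
        using small[OF that] r(2) by (auto simp: dist_norm mem_ball subset_iff norm_minus_commute add.assoc)
      define \<phi> where "\<phi> s = f (x + s *\<^sub>R u + t *\<^sub>R v) - f (x + s *\<^sub>R u)" for s
      have d\<phi>: "(\<phi> has_derivative (\<lambda>k. (g (x + s *\<^sub>R u + t *\<^sub>R v) - g (x + s *\<^sub>R u)) \<bullet> (k *\<^sub>R u))) (at s)"
        if s: "0 \<le> s" "s \<le> t" for s
      proof -
        have 1: "(f has_derivative (\<lambda>h. g (x + s *\<^sub>R u + t *\<^sub>R v) \<bullet> h)) (at (x + s *\<^sub>R u + t *\<^sub>R v))"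
          using f inS[of s t] s t by simp
        have 2: "(f has_derivative (\<lambda>h. g (x + s *\<^sub>R u) \<bullet> h)) (at (x + s *\<^sub>R u))"
          using f inS[of s 0] s t by simp
        have a: "((\<lambda>s. x + s *\<^sub>R u + t *\<^sub>R v) has_derivative (\<lambda>k. k *\<^sub>R u)) (at s)"
          by (auto intro!: derivative_eq_intros)
        have b: "((\<lambda>s. x + s *\<^sub>R u) has_derivative (\<lambda>k. k *\<^sub>R u)) (at s)"
          by (auto intro!: derivative_eq_intros)
        show ?thesis
          unfolding \<phi>_def using has_derivative_diff[OF has_derivative_compose[OF a 1] has_derivative_compose[OF b 2]]
          by (simp add: inner_diff_left algebra_simps)
      qed
      have "\<exists>\<xi>\<in>{0<..<t}. \<phi> t - \<phi> 0 = (g (x + \<xi> *\<^sub>R u + t *\<^sub>R v) - g (x + \<xi> *\<^sub>R u)) \<bullet> ((t - 0) *\<^sub>R u)"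
        using mvt_simple[OF t(1), of \<phi> "\<lambda>s k. (g (x + s *\<^sub>R u + t *\<^sub>R v) - g (x + s *\<^sub>R u)) \<bullet> (k *\<^sub>R u)"]
          d\<phi> has_derivative_at_withinI by (metis atLeastAtMost_iff)
      then obtain \<xi> where \<xi>: "0 < \<xi>" "\<xi> < t"
        and mv: "\<phi> t - \<phi> 0 = (g (x + \<xi> *\<^sub>R u + t *\<^sub>R v) - g (x + \<xi> *\<^sub>R u)) \<bullet> (t *\<^sub>R u)" by auto
      define a where "a = g (x + \<xi> *\<^sub>R u + t *\<^sub>R v) - g x - L (\<xi> *\<^sub>R u + t *\<^sub>R v)"
      define b where "b = g (x + \<xi> *\<^sub>R u) - g x - L (\<xi> *\<^sub>R u)"
      have "norm a \<le> \<epsilon> * norm (\<xi> *\<^sub>R u + t *\<^sub>R v)"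
        unfolding a_def using d(2)[of "x + \<xi> *\<^sub>R u + t *\<^sub>R v"] small[of \<xi> t] \<xi> t by (simp add: add.assoc)
      also have "\<dots> \<le> \<epsilon> * (t * norm u + t * norm v)"
      proof (intro mult_left_mono)
        show "norm (\<xi> *\<^sub>R u + t *\<^sub>R v) \<le> t * norm u + t * norm v"
          using norm_triangle_ineq[of "\<xi> *\<^sub>R u" "t *\<^sub>R v"] \<xi> t
            mult_right_mono[of \<xi> t "norm u"] by simp
      qed (use eps in auto)
      finally have na: "norm a \<le> \<epsilon> * (t * norm u + t * norm v)" .
      have "norm b \<le> \<epsilon> * norm (\<xi> *\<^sub>R u)"
        unfolding b_def using d(2)[of "x + \<xi> *\<^sub>R u"] small[of \<xi> 0] \<xi> t by simp
      also have "\<dots> \<le> \<epsilon> * (t * norm u)"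
        using \<xi> eps mult_right_mono[of \<xi> t "norm u"] by simp
      finally have nb: "norm b \<le> \<epsilon> * (t * norm u)" .
      have incr: "g (x + \<xi> *\<^sub>R u + t *\<^sub>R v) - g (x + \<xi> *\<^sub>R u) = t *\<^sub>R L v + (a - b)"
        unfolding a_def b_def using lin by (simp add: linear_add linear_scale)
      have "(\<phi> t - \<phi> 0) - t\<^sup>2 * (L v \<bullet> u) = (a - b) \<bullet> (t *\<^sub>R u)"
        unfolding mv incr by (simp add: inner_add_left power2_eq_square distrib_left)
      also have "\<bar>\<dots>\<bar> \<le> norm (a - b) * norm (t *\<^sub>R u)" by (rule Cauchy_Schwarz_ineq2)
      also have "\<dots> \<le> (\<epsilon> * (t * norm u + t * norm v) + \<epsilon> * (t * norm u)) * norm (t *\<^sub>R u)"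
        using na nb norm_triangle_ineq4[of a b] by (intro mult_right_mono) auto
      also have "\<dots> = \<epsilon> * t\<^sup>2 * (2 * norm u + norm v) * norm u"
        using t by (simp add: power2_eq_square algebra_simps)
      finally show ?thesis by (simp add: \<phi>_def algebra_simps)
    qed
    ultimately show ?thesis by blast
  qed
  define M where "M = (2 * norm u + norm v) * norm u + (2 * norm v + norm u) * norm v + 1"
  have M: "M > 0" unfolding M_def by (intro add_nonneg_pos add_nonneg_nonneg mult_nonneg_nonneg) auto
  have "\<bar>L v \<bullet> u - L u \<bullet> v\<bar> \<le> \<epsilon>" if e: "\<epsilon> > 0" for \<epsilon>
  proof -
    have e': "\<epsilon> / M > 0" using e M by simp
    obtain t1 where t1: "t1 > 0" "\<And>t. 0 < t \<and> t < t1 \<Longrightarrow>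
      \<bar>(f (x + t *\<^sub>R u + t *\<^sub>R v) - f (x + t *\<^sub>R u) - f (x + t *\<^sub>R v) + f x) - t\<^sup>2 * (L v \<bullet> u)\<bar>
        \<le> \<epsilon> / M * t\<^sup>2 * (2 * norm u + norm v) * norm u" using diff[OF e'] by blast
    obtain t2 where t2: "t2 > 0" "\<And>t. 0 < t \<and> t < t2 \<Longrightarrow>
      \<bar>(f (x + t *\<^sub>R v + t *\<^sub>R u) - f (x + t *\<^sub>R v) - f (x + t *\<^sub>R u) + f x) - t\<^sup>2 * (L u \<bullet> v)\<bar>
        \<le> \<epsilon> / M * t\<^sup>2 * (2 * norm v + norm u) * norm v" using diff[OF e'] by blast
    define t where "t = min t1 t2 / 2"
    have t: "0 < t" "t < t1" "t < t2" using t1 t2 by (auto simp: t_def)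
    define \<Delta> where "\<Delta> = f (x + t *\<^sub>R u + t *\<^sub>R v) - f (x + t *\<^sub>R u) - f (x + t *\<^sub>R v) + f x"
    have 1: "\<bar>\<Delta> - t\<^sup>2 * (L v \<bullet> u)\<bar> \<le> \<epsilon> / M * t\<^sup>2 * (2 * norm u + norm v) * norm u"
      using t1(2)[of t] t by (simp add: \<Delta>_def)
    have "x + t *\<^sub>R v + t *\<^sub>R u = x + t *\<^sub>R u + t *\<^sub>R v" by simp
    then have 2: "\<bar>\<Delta> - t\<^sup>2 * (L u \<bullet> v)\<bar> \<le> \<epsilon> / M * t\<^sup>2 * (2 * norm v + norm u) * norm v"
      using t2(2)[of t] t by (simp add: \<Delta>_def algebra_simps)
    have factor: "k * t\<^sup>2 * (2 * norm v + norm u) * norm v + k * t\<^sup>2 * (2 * norm u + norm v) * norm u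
        = t\<^sup>2 * (k * (M - 1))" for k
      unfolding M_def by (simp add: algebra_simps)
    have "t\<^sup>2 * \<bar>L v \<bullet> u - L u \<bullet> v\<bar> = \<bar>(\<Delta> - t\<^sup>2 * (L u \<bullet> v)) - (\<Delta> - t\<^sup>2 * (L v \<bullet> u))\<bar>"
      by (simp add: abs_mult right_diff_distrib[symmetric])
    also have "\<dots> \<le> \<epsilon> / M * t\<^sup>2 * (2 * norm v + norm u) * norm v + \<epsilon> / M * t\<^sup>2 * (2 * norm u + norm v) * norm u"
      using 1 2 by linarith
    also have "\<dots> = t\<^sup>2 * (\<epsilon> / M * (M - 1))" by (rule factor)
    also have "\<dots> \<le> t\<^sup>2 * \<epsilon>" using e M by (intro mult_left_mono) (auto simp: field_simps)
    finally show ?thesis using t by simp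
  qed
  then have "\<bar>L v \<bullet> u - L u \<bullet> v\<bar> \<le> 0" using field_le_epsilon by (metis add_0)
  then show ?thesis by simp
qed

text \<open>The last identity is Schwarz's theorem for the function \<open>g \<bullet> c\<close>, whose gradient is \<open>P c\<close>. Together the
identities say that the third derivative is a symmetric trilinear form.\<close>

lemma third_order_jet_symmetric:
  assumes f: "third_order_jet S f g P Q" and x: "x \<in> S"
  shows "P x u \<bullet> v = u \<bullet> P x v"
    and "Q x h u \<bullet> v = u \<bullet> Q x h v"
    and "Q x h u = Q x u h"
proof -
  have P: "P y u \<bullet> v = u \<bullet> P y v" if "y \<in> S" for y u v
    using derivative_of_gradient_symmetric[OF third_order_jetD(1)[OF f] that
      third_order_jetD(2)[OF f] third_order_jetD(3)[OF f that], where u=u and v=v]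
    by (simp add: inner_commute)
  show "P x u \<bullet> v = u \<bullet> P x v" by (rule P[OF x])
  have dP: "((\<lambda>y. P y u) has_derivative (\<lambda>h. Q x h u)) (at x)" for u
    using third_order_jetD(4)[OF f x] by (rule bounded_linear.has_derivative[OF blinfun.bounded_linear_left])
  have Q: "Q x h u \<bullet> v = u \<bullet> Q x h v" for h u v
  proof -
    have 1: "((\<lambda>y. P y u \<bullet> v) has_derivative (\<lambda>h. Q x h u \<bullet> v)) (at x)"
      by (rule has_derivative_inner_left[OF dP])
    have 2: "((\<lambda>y. u \<bullet> P y v) has_derivative (\<lambda>h. u \<bullet> Q x h v)) (at x)"
      by (rule has_derivative_inner_right[OF dP])
    from has_derivative_eq_on_open[OF third_order_jetD(1)[OF f] x 1 2 P] show ?thesis by metis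
  qed
  show "Q x h u \<bullet> v = u \<bullet> Q x h v" by (rule Q)
  have "Q x h u \<bullet> c = Q x u h \<bullet> c" for c
  proof -
    have "((\<lambda>y. g y \<bullet> c) has_derivative (\<lambda>h. P y c \<bullet> h)) (at y)" if "y \<in> S" for y
      using has_derivative_inner_left[OF third_order_jetD(3)[OF f that], of c] P[OF that]
      by (simp add: inner_commute)
    from derivative_of_gradient_symmetric[OF third_order_jetD(1)[OF f] x this dP]
    have "Q x h c \<bullet> u = Q x u c \<bullet> h" by blast
    then show ?thesis by (metis Q inner_commute)
  qed
  then show "Q x h u = Q x u h" by (metis vector_eq_rdot)
qed

text \<open>The Riesz isomorphism \<open>R\<close> from functionals to vectors converts the nested derivatives.\<close>

lemma C3_on_third_order_jet:
  assumes C3: "C3_on S F" and S: "open S"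
  obtains g P Q where "third_order_jet S F g P Q"
    and "\<And>x h. D1 F x h = g x \<bullet> h"
    and "\<And>x. hess F x = blinfun_apply (P x)"
proof
  have blR: "bounded_linear (\<lambda>\<phi>::'a \<Rightarrow>\<^sub>L real. \<Sum>b\<in>Basis. blinfun_apply \<phi> b *\<^sub>R b)"
    by (intro bounded_linear_intros)
  define R :: "('a \<Rightarrow>\<^sub>L real) \<Rightarrow>\<^sub>L 'a" where "R = Blinfun (\<lambda>\<phi>. \<Sum>b\<in>Basis. blinfun_apply \<phi> b *\<^sub>R b)"
  have R: "R \<phi> = (\<Sum>b\<in>Basis. blinfun_apply \<phi> b *\<^sub>R b)" for \<phi>
    unfolding R_def by (simp add: bounded_linear_Blinfun_apply[OF blR])
  have R_inner: "R \<phi> \<bullet> h = \<phi> h" for \<phi> h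
  proof -
    have "\<phi> h = \<phi> (\<Sum>b\<in>Basis. (h \<bullet> b) *\<^sub>R b)" by (simp add: euclidean_representation)
    then show ?thesis
      by (simp add: R blinfun.sum_right blinfun.scaleR_right inner_sum_left inner_commute[of h] mult.commute)
  qed
  have blC: "bounded_linear (\<lambda>T. R o\<^sub>L T :: 'a \<Rightarrow>\<^sub>L 'a)" by (intro bounded_linear_intros)
  define C where "C = Blinfun (\<lambda>T. R o\<^sub>L T :: 'a \<Rightarrow>\<^sub>L 'a)"
  have C: "blinfun_apply C = (\<lambda>T. R o\<^sub>L T)"
    unfolding C_def by (rule bounded_linear_Blinfun_apply[OF blC])
  define g where "g x = R (fderiv F x)" for x
  define P where "P x = R o\<^sub>L fderiv (fderiv F) x" for x
  define Q where "Q x = C o\<^sub>L fderiv (fderiv (fderiv F)) x" for x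
  show "D1 F x h = g x \<bullet> h" for x h by (simp add: D1_def g_def R_inner)
  show "hess F x = blinfun_apply (P x)" for x
    by (rule ext) (simp add: hess_def P_def R D2_def)
  show "third_order_jet S F g P Q"
    unfolding third_order_jet_def
  proof (intro conjI ballI)
    fix x assume x: "x \<in> S"
    have d: "F differentiable (at x)" "fderiv F differentiable (at x)"
      "fderiv (fderiv F) differentiable (at x)" using C3 x by (auto simp: C3_on_def)
    show "(F has_derivative (\<lambda>h. g x \<bullet> h)) (at x)"
      using fderiv_has_derivative[OF d(1)] by (simp add: g_def R_inner)
    show "(g has_derivative blinfun_apply (P x)) (at x)"
      unfolding g_def P_def blinfun_compose.rep_eq o_def
      by (rule bounded_linear.has_derivative[OF blinfun.bounded_linear_right fderiv_has_derivative[OF d(2)]])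
    show "(P has_derivative blinfun_apply (Q x)) (at x)"
      unfolding P_def[abs_def] Q_def blinfun_compose.rep_eq o_def C
      by (rule bounded_linear.has_derivative[OF blC fderiv_has_derivative[OF d(3)]])
  qed (rule S)
qed

text \<open>Differentiating \<open>f (t x) = f x - \<nu> ln t\<close> in \<open>x\<close> shows that \<open>g\<close> and \<open>P\<close> are homogeneous of degrees
\<open>-1\<close> and \<open>-2\<close>; the claims are the derivatives of the three homogeneity relations in \<open>t\<close> at \<open>1\<close>.\<close>

lemma logarithmically_homogeneous_jet:
  assumes f: "third_order_jet S f g P Q"
    and scale: "\<And>x t. x \<in> S \<Longrightarrow> t > 0 \<Longrightarrow> t *\<^sub>R x \<in> S"
    and hom: "\<And>x t. x \<in> S \<Longrightarrow> t > 0 \<Longrightarrow> f (t *\<^sub>R x) = f x - \<nu> * ln t"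
    and x: "x \<in> S"
  shows "g x \<bullet> x = - \<nu>" "P x x = - g x" "Q x x = - 2 *\<^sub>R P x"
proof -
  have gh: "t *\<^sub>R g (t *\<^sub>R x) = g x" and Ph: "(t * t) *\<^sub>R P (t *\<^sub>R x) = P x"
    if t: "t > 0" for t
  proof -
    define A where "A = t *\<^sub>R (id_blinfun :: 'a \<Rightarrow>\<^sub>L 'a)"
    have A: "A y = t *\<^sub>R y" for y by (simp add: A_def blinfun.scaleR_left)
    obtain Q' where "third_order_jet S (\<lambda>x. f (A x)) (\<lambda>x. A (g (A x))) (\<lambda>x. A o\<^sub>L P (A x) o\<^sub>L A) Q'"
      by (rule third_order_jet_compose_linear[OF f, of A A]) (auto simp: A scale t)
    from third_order_jet_unique[OF f this _ x, of "- \<nu> * ln t"]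
    have *: "A (g (A x)) = g x" "A o\<^sub>L P (A x) o\<^sub>L A = P x" using hom t by (auto simp: A)
    show "t *\<^sub>R g (t *\<^sub>R x) = g x" using *(1) by (simp add: A)
    have "((t * t) *\<^sub>R P (t *\<^sub>R x)) u = P x u" for u
    proof -
      have "(A o\<^sub>L P (A x) o\<^sub>L A) u = P x u" using *(2) by simp
      then show ?thesis by (simp add: A blinfun.scaleR_left blinfun.scaleR_right)
    qed
    then show "(t * t) *\<^sub>R P (t *\<^sub>R x) = P x" by (rule blinfun_eqI)
  qed
  have line: "((\<lambda>t. t *\<^sub>R x) has_derivative (\<lambda>k. k *\<^sub>R x)) (at (1::real))"
    by (auto intro!: derivative_eq_intros)
  have o: "open {0::real<..}" "(1::real) \<in> {0<..}" by auto
  have "((\<lambda>t. f (t *\<^sub>R x)) has_derivative (\<lambda>k. g x \<bullet> (k *\<^sub>R x))) (at 1)"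
    using has_derivative_compose[OF line, of f "\<lambda>h. g x \<bullet> h"] third_order_jetD(2)[OF f x] by simp
  moreover have "((\<lambda>t. f x - \<nu> * ln t) has_derivative (\<lambda>k. - \<nu> * k)) (at 1)"
    by (auto intro!: derivative_eq_intros)
  ultimately have "(\<lambda>k. g x \<bullet> (k *\<^sub>R x)) = (\<lambda>k. - \<nu> * k)"
    by (rule has_derivative_eq_on_open[OF o]) (use hom x in auto)
  from fun_cong[OF this, of 1] show "g x \<bullet> x = - \<nu>" by simp
  have "((\<lambda>t. g (t *\<^sub>R x)) has_derivative (\<lambda>k. P x (k *\<^sub>R x))) (at 1)"
    using has_derivative_compose[OF line, of g "P x"] third_order_jetD(3)[OF f x] by simp
  then have "((\<lambda>t. t *\<^sub>R g (t *\<^sub>R x)) has_derivative (\<lambda>k. P x (k *\<^sub>R x) + k *\<^sub>R g x)) (at 1)"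
    by (auto intro!: derivative_eq_intros)
  moreover have "((\<lambda>t::real. g x) has_derivative (\<lambda>k. 0)) (at 1)" by simp
  ultimately have "(\<lambda>k. P x (k *\<^sub>R x) + k *\<^sub>R g x) = (\<lambda>k. 0)"
    by (rule has_derivative_eq_on_open[OF o]) (use gh in auto)
  from fun_cong[OF this, of 1] show "P x x = - g x" by (simp add: eq_neg_iff_add_eq_0)
  have "((\<lambda>t. P (t *\<^sub>R x)) has_derivative (\<lambda>k. Q x (k *\<^sub>R x))) (at 1)"
    using has_derivative_compose[OF line, of P "Q x"] third_order_jetD(4)[OF f x] by simp
  then have "((\<lambda>t. (t * t) *\<^sub>R P (t *\<^sub>R x)) has_derivative (\<lambda>k. Q x (k *\<^sub>R x) + (k + k) *\<^sub>R P x)) (at 1)"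
    by (auto intro!: derivative_eq_intros)
  moreover have "((\<lambda>t::real. P x) has_derivative (\<lambda>k. 0)) (at 1)" by simp
  ultimately have "(\<lambda>k. Q x (k *\<^sub>R x) + (k + k) *\<^sub>R P x) = (\<lambda>k. 0)"
    by (rule has_derivative_eq_on_open[OF o]) (use Ph in auto)
  from fun_cong[OF this, of 1] show "Q x x = - 2 *\<^sub>R P x"
    by (simp add: eq_neg_iff_add_eq_0)
qed

section \<open>Self-adjoint operators\<close>

definition self_adjoint :: "('a::euclidean_space \<Rightarrow>\<^sub>L 'a) \<Rightarrow> bool" where
  "self_adjoint A \<longleftrightarrow> (\<forall>x y. A x \<bullet> y = x \<bullet> A y)"

definition positive_definite :: "('a::euclidean_space \<Rightarrow>\<^sub>L 'a) \<Rightarrow> bool" where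
  "positive_definite A \<longleftrightarrow> self_adjoint A \<and> (\<forall>x. x \<noteq> 0 \<longrightarrow> 0 < A x \<bullet> x)"

lemma self_adjointD: "self_adjoint A \<Longrightarrow> A x \<bullet> y = x \<bullet> A y"
  by (simp add: self_adjoint_def)

lemma positive_definiteD:
  "positive_definite A \<Longrightarrow> self_adjoint A"
  "positive_definite A \<Longrightarrow> x \<noteq> 0 \<Longrightarrow> 0 < A x \<bullet> x"
  "positive_definite A \<Longrightarrow> 0 \<le> A x \<bullet> x"
  by (auto simp: positive_definite_def) (metis blinfun.zero_right inner_zero_left less_eq_real_def)

text \<open>The form is nonnegative at \<open>v - t R v\<close>; its term linear in \<open>t\<close> would be negative for small \<open>t > 0\<close> if \<open>R v\<close> were nonzero.\<close>

lemma nonneg_form_null_vector: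
  fixes R :: "'a::real_inner \<Rightarrow> 'a"
  assumes lin: "linear R" and W: "subspace W"
    and RW: "\<And>u. u \<in> W \<Longrightarrow> R u \<in> W"
    and sym: "\<And>u v. R u \<bullet> v = u \<bullet> R v"
    and pos: "\<And>u. u \<in> W \<Longrightarrow> 0 \<le> R u \<bullet> u"
    and v: "v \<in> W" "R v \<bullet> v = 0"
  shows "R v = 0"
proof (rule ccontr)
  assume nz: "R v \<noteq> 0"
  define w where "w = R v"
  define a where "a = w \<bullet> w"
  define b where "b = R w \<bullet> w"
  have a: "a > 0" using nz by (simp add: a_def w_def)
  have wW: "w \<in> W" using RW v by (simp add: w_def)
  have b: "b \<ge> 0" using pos[OF wW] by (simp add: b_def)
  have q: "0 \<le> - 2 * t * a + t\<^sup>2 * b" for t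
  proof -
    have "v - t *\<^sub>R w \<in> W" using W v wW by (simp add: subspace_diff subspace_scale)
    from pos[OF this] have "0 \<le> R (v - t *\<^sub>R w) \<bullet> (v - t *\<^sub>R w)" .
    also have "\<dots> = - 2 * t * a + t\<^sup>2 * b"
      using v(2) sym[of w v] lin
      by (simp add: linear_diff linear_scale inner_diff_left inner_diff_right a_def b_def w_def
          power2_eq_square algebra_simps inner_commute)
    finally show ?thesis .
  qed
  define t where "t = a / (b + 1)"
  have t: "t > 0" using a b by (simp add: t_def)
  have tb: "t * b \<le> a"
    using a b by (simp add: t_def field_simps)
  have "0 \<le> t * (- 2 * a + t * b)" using q[of t] by (simp add: power2_eq_square algebra_simps)
  then have "0 \<le> - 2 * a + t * b" using t by (simp add: zero_le_mult_iff)
  with tb a show False by linarith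
qed

text \<open>A maximizer of the Rayleigh quotient on the unit sphere of \<open>W\<close> is an eigenvector.\<close>

lemma self_adjoint_eigenvector_in_invariant_subspace:
  fixes S :: "'a::euclidean_space \<Rightarrow>\<^sub>L 'a"
  assumes S: "self_adjoint S" and W: "subspace W" "W \<noteq> {0}"
    and SW: "\<And>u. u \<in> W \<Longrightarrow> S u \<in> W"
  obtains v c where "v \<in> W" "v \<noteq> 0" "S v = c *\<^sub>R v"
proof -
  define X where "X = W \<inter> sphere 0 1"
  have cX: "compact X" unfolding X_def using closed_subspace[OF W(1)] by (intro closed_Int_compact) auto
  obtain w where w: "w \<in> W" "w \<noteq> 0" using W subspace_0 by blast
  then have "w /\<^sub>R norm w \<in> X" unfolding X_def using W by (simp add: subspace_scale)
  then have nX: "X \<noteq> {}" by blast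
  have cont: "continuous_on X (\<lambda>v. S v \<bullet> v)" by (intro continuous_intros)
  obtain v where v: "v \<in> X" and max: "\<And>u. u \<in> X \<Longrightarrow> S u \<bullet> u \<le> S v \<bullet> v"
    using continuous_attains_sup[OF cX nX cont] by blast
  define c where "c = S v \<bullet> v"
  have vW: "v \<in> W" and nv: "norm v = 1" using v by (auto simp: X_def)
  have maxW: "S u \<bullet> u \<le> c * (u \<bullet> u)" if u: "u \<in> W" for u
  proof (cases "u = 0")
    case False
    then have "u /\<^sub>R norm u \<in> X" unfolding X_def using u W by (simp add: subspace_scale)
    moreover have "S (k *\<^sub>R u) \<bullet> (k *\<^sub>R u) = (S u \<bullet> u) * k\<^sup>2" for k
      by (simp add: blinfun.scaleR_right power2_eq_square)
    ultimately have "(S u \<bullet> u) * (inverse (norm u))\<^sup>2 \<le> c" using max unfolding c_def by metis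
    then have "(S u \<bullet> u) / (norm u)\<^sup>2 \<le> c" by (simp only: divide_inverse power_inverse)
    then show ?thesis using False by (simp add: pos_divide_le_eq dot_square_norm)
  qed simp
  define R where "R u = c *\<^sub>R u - S u" for u
  have "linear R"
    unfolding R_def by (rule linearI) (simp_all add: blinfun.bilinear_simps algebra_simps)
  then have "R v = 0"
  proof (rule nonneg_form_null_vector[OF _ W(1)])
    show "R u \<in> W" if "u \<in> W" for u
      unfolding R_def using that W SW by (simp add: subspace_diff subspace_scale)
    show "R u \<bullet> w = u \<bullet> R w" for u w
      by (simp add: R_def inner_diff_left inner_diff_right self_adjointD[OF S])
    show "0 \<le> R u \<bullet> u" if "u \<in> W" for u
      using maxW[OF that] by (simp add: R_def inner_diff_left)
    show "R v \<bullet> v = 0" using nv by (simp add: R_def inner_diff_left c_def dot_square_norm)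
  qed (rule vW)
  then have "S v = c *\<^sub>R v" by (simp add: R_def)
  moreover have "v \<noteq> 0" using nv by auto
  ultimately show thesis using that vW by blast
qed

text \<open>Eigenvectors for different eigenvalues are orthogonal.\<close>

lemma self_adjoint_finite_spectrum:
  fixes S :: "'a::euclidean_space \<Rightarrow>\<^sub>L 'a"
  assumes S: "self_adjoint S"
  shows "finite {c. \<exists>v. v \<noteq> 0 \<and> S v = c *\<^sub>R v}" (is "finite ?\<Lambda>")
proof -
  have "\<forall>c\<in>?\<Lambda>. \<exists>v. v \<noteq> 0 \<and> S v = c *\<^sub>R v" by simp
  from bchoice[OF this] obtain v where v: "\<And>c. c \<in> ?\<Lambda> \<Longrightarrow> v c \<noteq> 0 \<and> S (v c) = c *\<^sub>R v c"
    by blast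
  have orth: "v c \<bullet> v d = 0" if "c \<in> ?\<Lambda>" "d \<in> ?\<Lambda>" "c \<noteq> d" for c d
  proof -
    have "c * (v c \<bullet> v d) = d * (v c \<bullet> v d)"
      using self_adjointD[OF S, of "v c" "v d"] v[OF that(1)] v[OF that(2)] by simp
    then show ?thesis using that(3) by simp
  qed
  have "inj_on v ?\<Lambda>"
  proof (rule inj_onI, rule ccontr)
    fix c d assume "c \<in> ?\<Lambda>" "d \<in> ?\<Lambda>" "v c = v d" "c \<noteq> d"
    then show False using orth[of c d] v[of c] by (metis inner_eq_zero_iff)
  qed
  moreover have "independent (v ` ?\<Lambda>)"
  proof (rule pairwise_orthogonal_independent)
    show "pairwise orthogonal (v ` ?\<Lambda>)"
      unfolding pairwise_def orthogonal_def using orth by auto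
    show "0 \<notin> v ` ?\<Lambda>" using v by fastforce
  qed
  then have "finite (v ` ?\<Lambda>)" by (rule independent_imp_finite)
  ultimately show ?thesis using finite_imageD by blast
qed

text \<open>If \<open>S' \<noteq> S\<close>, then \<open>S\<close> and \<open>S'\<close> have a common eigenvector in the range of \<open>S' - S\<close>. Its two
eigenvalues differ, since the range of a self-adjoint operator meets the kernel only in \<open>0\<close>, and both
belong to the finite spectrum of \<open>S\<close>. So \<open>\<delta>\<close> is the smallest gap in that spectrum.\<close>

lemma commuting_isospectral_isolated:
  fixes S :: "'a::euclidean_space \<Rightarrow>\<^sub>L 'a"
  assumes S: "self_adjoint S"
  obtains \<delta> where "\<delta> > 0"
    and "\<And>S'. self_adjoint S' \<Longrightarrow> (\<And>v. S (blinfun_apply S' v) = S' (S v)) \<Longrightarrow>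
      (\<And>c v. v \<noteq> 0 \<Longrightarrow> S' v = c *\<^sub>R v \<Longrightarrow> \<exists>w. w \<noteq> 0 \<and> S w = c *\<^sub>R w) \<Longrightarrow> S' \<noteq> S \<Longrightarrow>
      \<exists>v c. v \<noteq> 0 \<and> \<delta> \<le> \<bar>c\<bar> \<and> S' v - S v = c *\<^sub>R v"
proof -
  define \<Lambda> where "\<Lambda> = {c. \<exists>v. v \<noteq> 0 \<and> S v = c *\<^sub>R v}"
  have fin: "finite \<Lambda>" unfolding \<Lambda>_def by (rule self_adjoint_finite_spectrum[OF S])
  define D where "D = insert 1 ((\<lambda>(c, d). \<bar>c - d\<bar>) ` {(c, d). c \<in> \<Lambda> \<and> d \<in> \<Lambda> \<and> c \<noteq> d})"
  have "{(c, d). c \<in> \<Lambda> \<and> d \<in> \<Lambda> \<and> c \<noteq> d} \<subseteq> \<Lambda> \<times> \<Lambda>" by blast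
  then have "finite D" unfolding D_def using fin finite_subset by fast
  define \<delta> where "\<delta> = Min D"
  have "D \<noteq> {}" "\<And>d. d \<in> D \<Longrightarrow> 0 < d" by (auto simp: D_def)
  then have "\<delta> > 0" unfolding \<delta>_def using Min_in[OF \<open>finite D\<close>] by blast
  moreover have gap: "\<delta> \<le> \<bar>c - d\<bar>" if "c \<in> \<Lambda>" "d \<in> \<Lambda>" "c \<noteq> d" for c d
    unfolding \<delta>_def by (rule Min_le[OF \<open>finite D\<close>]) (use that in \<open>auto simp: D_def\<close>)
  have "\<exists>v c. v \<noteq> 0 \<and> \<delta> \<le> \<bar>c\<bar> \<and> S' v - S v = c *\<^sub>R v"
    if S': "self_adjoint S'" and comm: "\<And>v. S (S' v) = S' (S v)"
      and spec: "\<And>c v. v \<noteq> 0 \<Longrightarrow> S' v = c *\<^sub>R v \<Longrightarrow> \<exists>w. w \<noteq> 0 \<and> S w = c *\<^sub>R w"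
      and ne: "S' \<noteq> S" for S'
  proof -
    define W where "W = range (blinfun_apply (S' - S))"
    have W: "subspace W"
      unfolding W_def by (rule subspace_UNIV[THEN linear_subspace_image[OF blinfun_linear]])
    have "W \<noteq> {0}"
    proof
      assume "W = {0}"
      then have "(S' - S) u = 0" for u unfolding W_def by blast
      then show False using ne blinfun_eqI by (metis blinfun.diff_left eq_iff_diff_eq_0)
    qed
    have "S u \<in> W" if "u \<in> W" for u
    proof -
      obtain z where "u = (S' - S) z" using \<open>u \<in> W\<close> by (auto simp: W_def)
      then have "S u = (S' - S) (S z)" by (simp add: blinfun.bilinear_simps comm)
      then show ?thesis by (auto simp: W_def)
    qed
    then obtain v0 c where v0: "v0 \<in> W" "v0 \<noteq> 0" "S v0 = c *\<^sub>R v0"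
      using self_adjoint_eigenvector_in_invariant_subspace[OF S W \<open>W \<noteq> {0}\<close>] by blast
    define W' where "W' = W \<inter> {u. S u = c *\<^sub>R u}"
    have "subspace {u. S u = c *\<^sub>R u}"
      by (rule subspaceI) (simp_all add: blinfun.bilinear_simps algebra_simps)
    then have W': "subspace W'" unfolding W'_def using W by (rule subspace_inter[rotated])
    moreover have "W' \<noteq> {0}" using v0 by (auto simp: W'_def)
    moreover have "S' u \<in> W'" if "u \<in> W'" for u
    proof -
      obtain z where z: "u = (S' - S) z" using \<open>u \<in> W'\<close> by (auto simp: W'_def W_def)
      then have "S' u = (S' - S) (S' z)" by (simp add: blinfun.bilinear_simps comm)
      then have "S' u \<in> W" by (auto simp: W_def)
      moreover have "S (S' u) = c *\<^sub>R S' u"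
        using \<open>u \<in> W'\<close> comm by (simp add: W'_def blinfun.scaleR_right)
      ultimately show ?thesis by (simp add: W'_def)
    qed
    ultimately obtain v d where v: "v \<in> W'" "v \<noteq> 0" "S' v = d *\<^sub>R v"
      using self_adjoint_eigenvector_in_invariant_subspace[OF S'] by blast
    have Sv: "S v = c *\<^sub>R v" using v by (simp add: W'_def)
    have "c \<noteq> d"
    proof
      assume "c = d"
      then have 0: "(S' - S) v = 0" by (simp add: blinfun.bilinear_simps v Sv)
      obtain z where z: "v = (S' - S) z" using v(1) by (auto simp: W'_def W_def)
      have "v \<bullet> v = z \<bullet> (S' - S) v"
        by (subst z) (simp add: blinfun.bilinear_simps inner_diff_left inner_diff_right
            self_adjointD[OF S] self_adjointD[OF S'])
      then show False using 0 v(2) by simp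
    qed
    moreover have "c \<in> \<Lambda>" "d \<in> \<Lambda>" using Sv v spec[OF v(2,3)] by (auto simp: \<Lambda>_def)
    ultimately have "\<delta> \<le> \<bar>d - c\<bar>" using gap[of d c] by auto
    moreover have "S' v - S v = (d - c) *\<^sub>R v" by (simp add: v Sv algebra_simps)
    ultimately show ?thesis using v(2) by blast
  qed
  ultimately show thesis using that by blast
qed

text \<open>The set of \<open>A\<close> commuting with \<open>S\<close> is closed. It is also open: if \<open>A\<close> is close to a member, then
\<open>S A - A S\<close> is small, so the conjugate of \<open>S\<close> by \<open>A\<close> is close to \<open>S\<close> and hence equal to it by
isolation. Closeness is tested on the eigenvector with eigenvalue at least \<open>\<delta>\<close> only, which avoids
the continuity of operator inversion.\<close>

lemma commutes_on_identity_component: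
  fixes S :: "'a::euclidean_space \<Rightarrow>\<^sub>L 'a"
  assumes S: "self_adjoint S"
    and bij: "\<And>A. A \<in> U \<Longrightarrow> bij (blinfun_apply A)"
    and conj: "\<And>A B. A \<in> U \<Longrightarrow> (\<And>x. blinfun_apply B (A x) = x) \<Longrightarrow>
      (\<And>x. A (blinfun_apply B x) = x) \<Longrightarrow> self_adjoint (B o\<^sub>L S o\<^sub>L A) \<and> (\<forall>v. S (B (S (A v))) = B (S (A (S v))))"
    and A: "A \<in> connected_component_set U id_blinfun"
  shows "A (S v) = S (A v)"
proof -
  obtain \<delta> where \<delta>: "\<delta> > 0" and isolated: "\<And>S'. self_adjoint S' \<Longrightarrow> (\<And>v. S (blinfun_apply S' v) = S' (S v)) \<Longrightarrow>
      (\<And>c v. v \<noteq> 0 \<Longrightarrow> S' v = c *\<^sub>R v \<Longrightarrow> \<exists>w. w \<noteq> 0 \<and> S w = c *\<^sub>R w) \<Longrightarrow> S' \<noteq> S \<Longrightarrow>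
      \<exists>v c. v \<noteq> 0 \<and> \<delta> \<le> \<bar>c\<bar> \<and> S' v - S v = c *\<^sub>R v"
    using commuting_isospectral_isolated[OF S] by blast
  define C where "C = connected_component_set U id_blinfun"
  define T where "T = C \<inter> {A :: 'a \<Rightarrow>\<^sub>L 'a. A o\<^sub>L S = S o\<^sub>L A}"
  have CU: "C \<subseteq> U" unfolding C_def by (rule connected_component_subset)
  have "connected C" unfolding C_def by (rule connected_connected_component)
  moreover have "closedin (top_of_set C) T"
    unfolding T_def
    by (intro closedin_closed_Int closed_Collect_eq continuous_intros)
  moreover have "openin (top_of_set C) T"
    unfolding openin_contains_ball
  proof (intro conjI ballI)
    show "T \<subseteq> C" by (auto simp: T_def)
    fix A0 assume A0: "A0 \<in> T"
    then have A0U: "A0 \<in> U" and comm0: "A0 o\<^sub>L S = S o\<^sub>L A0" using CU by (auto simp: T_def)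
    obtain B0 where B0: "\<And>x. blinfun_apply B0 (A0 x) = x" "\<And>x. A0 (blinfun_apply B0 x) = x"
      using blinfun_inverse_exists[OF bij[OF A0U]] by blast
    \<comment> \<open>\<open>A0\<close> shrinks no vector by more than the factor \<open>m\<close>, and \<open>\<epsilon>\<close> makes \<open>2 \<parallel>S\<parallel> \<epsilon> < \<delta> m / 2\<close>.\<close>
    define m where "m = 1 / (norm B0 + 1)"
    have n1: "norm B0 + 1 > 0" using norm_ge_zero[of B0] by linarith
    then have m: "m > 0" by (simp add: m_def)
    have lower: "m * norm v \<le> norm (A0 v)" for v
    proof -
      have "norm v \<le> norm B0 * norm (A0 v)" using norm_blinfun[of B0 "A0 v"] B0 by simp
      also have "\<dots> \<le> (norm B0 + 1) * norm (A0 v)" by (simp add: mult_right_mono)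
      finally show ?thesis using n1 by (simp add: m_def field_simps)
    qed
    define \<epsilon> where "\<epsilon> = min (m / 2) (\<delta> * m / (4 * norm S + 4))"
    have n2: "4 * norm S + 4 > 0" using norm_ge_zero[of S] by linarith
    have \<epsilon>: "\<epsilon> > 0" using m \<delta> n2 by (simp add: \<epsilon>_def)
    have "A \<in> T" if A: "A \<in> ball A0 \<epsilon> \<inter> C" for A
    proof (rule ccontr)
      assume nT: "A \<notin> T"
      have AU: "A \<in> U" using A CU by auto
      define E where "E = A - A0"
      have E: "norm E < \<epsilon>" using A by (simp add: E_def dist_norm norm_minus_commute)
      obtain B where B: "\<And>x. blinfun_apply B (A x) = x" "\<And>x. A (blinfun_apply B x) = x"
        using blinfun_inverse_exists[OF bij[OF AU]] by blast
      have ne: "B o\<^sub>L S o\<^sub>L A \<noteq> S"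
      proof
        assume *: "B o\<^sub>L S o\<^sub>L A = S"
        have "A (S v) = S (A v)" for v
        proof -
          have "S v = B (S (A v))" by (subst *[symmetric]) simp
          then show ?thesis by (simp add: B)
        qed
        then have "A o\<^sub>L S = S o\<^sub>L A" by (intro blinfun_eqI) simp
        then show False using nT A by (simp add: T_def)
      qed
      have spec: "\<exists>w. w \<noteq> 0 \<and> S w = c *\<^sub>R w" if "v \<noteq> 0" "(B o\<^sub>L S o\<^sub>L A) v = c *\<^sub>R v" for c v
      proof (intro exI conjI)
        show "A v \<noteq> 0" using that(1) B(1) by (metis blinfun.zero_right)
        show "S (A v) = c *\<^sub>R A v" using that(2) B(2)
          by (metis blinfun.scaleR_right blinfun_apply_blinfun_compose)
      qed
      obtain v c where v: "v \<noteq> 0" and c: "\<delta> \<le> \<bar>c\<bar>" and eig: "(B o\<^sub>L S o\<^sub>L A) v - S v = c *\<^sub>R v"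
        using isolated[OF _ _ _ ne] conj[OF AU B] spec by auto
      have "c *\<^sub>R A v = A (c *\<^sub>R v)" by (simp add: blinfun.scaleR_right)
      also have "\<dots> = S (A v) - A (S v)" by (simp add: eig[symmetric] blinfun.diff_right B)
      also have "\<dots> = S (E v) - E (S v)"
      proof -
        have "A0 (S v) = S (A0 v)" using comm0 by (metis blinfun_apply_blinfun_compose)
        then show ?thesis unfolding E_def by (simp add: blinfun.diff_left blinfun.diff_right)
      qed
      finally have eqE: "c *\<^sub>R A v = S (E v) - E (S v)" .
      have "norm (S (E v)) \<le> norm S * (norm E * norm v)"
        using norm_blinfun[of S "E v"] mult_left_mono[OF norm_blinfun[of E v] norm_ge_zero[of S]] by linarith
      moreover have "norm (E (S v)) \<le> norm E * (norm S * norm v)"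
        using norm_blinfun[of E "S v"] mult_left_mono[OF norm_blinfun[of S v] norm_ge_zero[of E]] by linarith
      moreover have "norm (c *\<^sub>R A v) \<le> norm (S (E v)) + norm (E (S v))"
        unfolding eqE by (rule norm_triangle_ineq4)
      ultimately have up: "\<bar>c\<bar> * norm (A v) \<le> 2 * norm S * norm E * norm v"
        by (simp add: mult.assoc mult.left_commute[of "norm E"])
      have "A v = A0 v + E v" by (simp add: E_def blinfun.bilinear_simps)
      then have "norm (A v) \<ge> norm (A0 v) - norm (E v)"
        by (metis norm_diff_ineq)
      moreover have "norm (E v) \<le> (m / 2) * norm v"
        using norm_blinfun[of E v] mult_right_mono[of "norm E" "m/2" "norm v"] E by (auto simp: \<epsilon>_def)
      ultimately have low: "m / 2 * norm v \<le> norm (A v)"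
        using lower[of v] by (simp add: field_simps)
      have "\<delta> * (m / 2 * norm v) \<le> \<bar>c\<bar> * norm (A v)"
        using low c \<delta> m by (intro mult_mono) auto
      also note up
      also have "2 * norm S * norm E * norm v < \<delta> * (m / 2 * norm v)"
      proof -
        have "norm E * (4 * norm S + 4) < \<delta> * m"
          using E n2 by (simp add: \<epsilon>_def field_simps)
        moreover have "norm E * (4 * norm S + 4) = 2 * (2 * norm S * norm E) + 4 * norm E"
          by (simp add: algebra_simps)
        moreover have "\<delta> * m = 2 * (\<delta> * (m / 2))" by simp
        ultimately have "2 * norm S * norm E < \<delta> * (m / 2)"
          using norm_ge_zero[of E] by linarith
        from mult_strict_right_mono[OF this, of "norm v"] v show ?thesis by (simp add: algebra_simps)
      qed
      finally show False by simp
    qed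
    with \<epsilon> show "\<exists>e>0. ball A0 e \<inter> C \<subseteq> T" by blast
  qed
  moreover have "T \<noteq> {}"
  proof -
    have "id_blinfun \<in> C"
      using A unfolding C_def by (metis connected_component_eq_empty connected_component_refl_eq empty_iff mem_Collect_eq)
    moreover have "id_blinfun o\<^sub>L S = S o\<^sub>L id_blinfun" by (rule blinfun_eqI) simp
    ultimately have "id_blinfun \<in> T" by (simp add: T_def)
    then show ?thesis by blast
  qed
  ultimately have "T = C" using connected_clopen by metis
  then have "A o\<^sub>L S = S o\<^sub>L A" using A by (auto simp: T_def C_def)
  then show ?thesis by (metis blinfun_apply_blinfun_compose)
qed

text \<open>Let \<open>a n\<close> be the value of the form \<open>S\<close> at \<open>R\<^sup>n v\<close> and \<open>v\<close>. The Cauchy-Schwarz inequality gives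
\<open>(a n)\<^sup>2 \<le> a (2 n) a 0\<close>, so if \<open>\<rho> = a 1 / a 0\<close> were greater than \<open>1\<close>, then \<open>a m \<ge> a 0 \<rho>\<^sup>m\<close>
for all powers \<open>m\<close> of two would contradict boundedness.\<close>

lemma power_bounded_symmetric_le_id:
  fixes S R :: "'a::euclidean_space \<Rightarrow>\<^sub>L 'a"
  assumes S: "positive_definite S"
    and sym: "\<And>u v. S (R u) \<bullet> v = S u \<bullet> R v"
    and bdd: "\<And>n. norm ((blinfun_apply R ^^ n) v) \<le> C"
  shows "S (R v) \<bullet> v \<le> S v \<bullet> v"
proof (rule ccontr)
  assume neg: "\<not> ?thesis"
  define B where "B x y = S x \<bullet> y" for x y
  have Bsym: "B x y = B y x" for x y
    using self_adjointD[OF positive_definiteD(1)[OF S]] by (simp add: B_def inner_commute)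
  have CS: "(B x y)\<^sup>2 \<le> B x x * B y y" for x y
  proof (cases "y = 0")
    case False
    then have D: "B y y > 0" using positive_definiteD(2)[OF S] by (simp add: B_def)
    define t where "t = B x y / B y y"
    have "0 \<le> B (x - t *\<^sub>R y) (x - t *\<^sub>R y)"
      unfolding B_def using positive_definiteD(3)[OF S] .
    also have "\<dots> = B x x - 2 * t * B x y + t * t * B y y"
      using Bsym[of y x] by (simp add: B_def blinfun.bilinear_simps inner_diff_left inner_diff_right algebra_simps)
    also have "\<dots> = B x x - (B x y)\<^sup>2 / B y y"
      using D by (simp add: t_def power2_eq_square field_simps)
    finally show ?thesis using D by (simp add: field_simps)
  qed (simp add: B_def)
  have v0: "v \<noteq> 0" using neg by auto
  have power_sym: "B ((blinfun_apply R ^^ n) x) y = B x ((blinfun_apply R ^^ n) y)" for n x y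
  proof (induction n arbitrary: y)
    case (Suc n)
    have "B (R ((blinfun_apply R ^^ n) x)) y = B ((blinfun_apply R ^^ n) x) (R y)"
      by (simp add: B_def sym)
    also have "\<dots> = B x ((blinfun_apply R ^^ n) (R y))" by (rule Suc)
    finally show ?case by (simp add: funpow_swap1)
  qed simp
  define a where "a n = B ((blinfun_apply R ^^ n) v) v" for n
  have a0: "a 0 > 0" unfolding a_def B_def using positive_definiteD(2)[OF S v0] by simp
  have double: "(a n)\<^sup>2 \<le> a (2 * n) * a 0" for n
    using CS[of "(blinfun_apply R ^^ n) v" v] power_sym[of n "(blinfun_apply R ^^ n) v" v]
    by (simp add: a_def mult_2 funpow_add)
  define \<rho> where "\<rho> = a 1 / a 0"
  have \<rho>: "\<rho> > 1" using neg a0 by (simp add: \<rho>_def a_def B_def)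
  have grow: "a 0 * \<rho> ^ (2 ^ k) \<le> a (2 ^ k)" for k
  proof (induction k)
    case 0 then show ?case using a0 by (simp add: \<rho>_def)
  next
    case (Suc k)
    have "(a 0 * \<rho> ^ (2 ^ k))\<^sup>2 \<le> (a (2 ^ k))\<^sup>2"
      using Suc a0 \<rho> by (intro power_mono) auto
    also have "\<dots> \<le> a (2 ^ Suc k) * a 0" using double[of "2 ^ k"] by simp
    finally have "a 0 * (a 0 * \<rho> ^ (2 ^ Suc k)) \<le> a 0 * a (2 ^ Suc k)"
      by (simp add: power_mult_distrib power_mult[symmetric] mult.commute power2_eq_square[of "a 0"] mult.left_commute)
    then show ?case using a0 by (simp del: power_Suc)
  qed
  define M where "M = norm S * C * norm v"
  have upper: "a n \<le> M" for n
  proof -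
    have "a n \<le> norm (S ((blinfun_apply R ^^ n) v)) * norm v"
      unfolding a_def B_def by (rule norm_cauchy_schwarz)
    also have "\<dots> \<le> norm S * C * norm v"
      using norm_blinfun[of S "(blinfun_apply R ^^ n) v"] mult_left_mono[OF bdd[of n] norm_ge_zero[of S]]
      by (intro mult_right_mono) auto
    finally show ?thesis by (simp add: M_def)
  qed
  obtain n where n: "M / a 0 < \<rho> ^ n" using real_arch_pow[OF \<rho>] by blast
  have "\<rho> ^ n \<le> \<rho> ^ (2 ^ n)" using \<rho> by (intro power_increasing) (auto simp: less_imp_le)
  then have "M / a 0 < \<rho> ^ (2 ^ n)" using n by linarith
  then have "M < a 0 * \<rho> ^ (2 ^ n)" using a0 by (simp add: field_simps)
  then show False using grow[of n] upper[of "2 ^ n"] by linarith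
qed

text \<open>With respect to the inner product given by \<open>S\<close>, boundedness of the positive powers gives \<open>R \<le> 1\<close> and that
of the negative powers \<open>R' \<le> 1\<close>. But \<open>R + R' - 2 = (R - 1) R' (R - 1) \<ge> 0\<close>, so \<open>R = 1\<close>.\<close>

lemma power_bounded_positive_imp_identity:
  fixes S R R' :: "'a::euclidean_space \<Rightarrow>\<^sub>L 'a"
  assumes S: "positive_definite S"
    and sym: "\<And>u v. S (R u) \<bullet> v = S u \<bullet> R v"
    and pos: "\<And>u. u \<noteq> 0 \<Longrightarrow> 0 < S (R u) \<bullet> u"
    and inv: "\<And>u. R' (R u) = u" "\<And>u. R (R' u) = u"
    and bdd: "\<And>n. norm ((blinfun_apply R ^^ n) v) \<le> C" "\<And>n. norm ((blinfun_apply R' ^^ n) v) \<le> C"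
  shows "R v = v"
proof (rule ccontr)
  assume ne: "R v \<noteq> v"
  have sym': "S (R' u) \<bullet> v = S u \<bullet> R' v" for u v
    by (metis sym inv(2))
  define w where "w = R v - v"
  have "w \<noteq> 0" using ne by (simp add: w_def)
  then have "R' w \<noteq> 0" using inv(2) by (metis blinfun.zero_right)
  from pos[OF this] have "0 < S w \<bullet> R' w" by (simp add: inv)
  also have "S w \<bullet> R' w = S (R v) \<bullet> v + S (R' v) \<bullet> v - 2 * (S v \<bullet> v)"
    using sym[of v "R' v"] sym'[of v v] inv
    by (simp add: w_def blinfun.bilinear_simps inner_diff_left inner_diff_right)
  also have "\<dots> \<le> 0"
    using power_bounded_symmetric_le_id[OF S sym bdd(1)] power_bounded_symmetric_le_id[OF S sym' bdd(2)]
    by linarith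
  finally show False by simp
qed

section \<open>Automorphisms of a self-dual cone\<close>

lemma Aut_coneI:
  fixes A B :: "'a::euclidean_space \<Rightarrow>\<^sub>L 'a"
  assumes "\<And>x. blinfun_apply B (A x) = x" "\<And>x. A (blinfun_apply B x) = x"
    and "\<And>x. x \<in> K \<Longrightarrow> A x \<in> K" "\<And>x. x \<in> K \<Longrightarrow> B x \<in> K"
  shows "A \<in> Aut_cone K"
proof -
  have "bij (blinfun_apply A)" by (rule o_bij[of "blinfun_apply B"]) (auto simp: assms)
  moreover have "blinfun_apply A ` K = K"
    using assms by (metis image_eqI image_subsetI subsetI subset_antisym)
  ultimately show ?thesis by (simp add: Aut_cone_def)
qed

lemma Aut_coneD:
  assumes "A \<in> Aut_cone K"
  shows "bij (blinfun_apply A)" "x \<in> K \<Longrightarrow> A x \<in> K" "blinfun_apply A ` interior K = interior K"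
    "x \<in> interior K \<Longrightarrow> A x \<in> interior K"
proof -
  show b: "bij (blinfun_apply A)" and "x \<in> K \<Longrightarrow> A x \<in> K" using assms by (auto simp: Aut_cone_def)
  show "blinfun_apply A ` interior K = interior K"
    using interior_injective_linear_image[OF blinfun_linear bij_is_inj[OF b], of K] assms
    by (simp add: Aut_cone_def)
  then show "x \<in> interior K \<Longrightarrow> A x \<in> interior K" by blast
qed

lemma interior_closed_under_scaling:
  fixes K :: "'a::euclidean_space set"
  assumes K: "\<And>t x. t > (0::real) \<Longrightarrow> x \<in> K \<Longrightarrow> t *\<^sub>R x \<in> K"
    and t: "t > 0" and x: "x \<in> interior K"
  shows "t *\<^sub>R x \<in> interior K"
proof -
  have "t *\<^sub>R id_blinfun \<in> Aut_cone K"
    by (rule Aut_coneI[of "inverse t *\<^sub>R id_blinfun"]) (use t K in \<open>auto simp: blinfun.scaleR_left\<close>)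
  from Aut_coneD(4)[OF this x] show ?thesis by (simp add: blinfun.scaleR_left)
qed

lemma Aut_cone_inverse:
  assumes A: "A \<in> Aut_cone K"
  obtains B where "B \<in> Aut_cone K" "\<And>x. blinfun_apply B (A x) = x" "\<And>x. A (blinfun_apply B x) = x"
proof -
  obtain B where B: "\<And>x. blinfun_apply B (A x) = x" "\<And>x. A (blinfun_apply B x) = x"
    using blinfun_inverse_exists[OF Aut_coneD(1)[OF A]] by blast
  have "B x \<in> K" if "x \<in> K" for x
  proof -
    obtain y where "y \<in> K" "x = A y" using A \<open>x \<in> K\<close> by (auto simp: Aut_cone_def)
    then show ?thesis using B by simp
  qed
  then have "B \<in> Aut_cone K" using B Aut_coneD(2)[OF A] by (intro Aut_coneI[of A B]) auto
  then show thesis using that B by blast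
qed

lemma Aut_cone_compose:
  assumes "A \<in> Aut_cone K" "B \<in> Aut_cone K"
  shows "A o\<^sub>L B \<in> Aut_cone K"
proof -
  have "bij (blinfun_apply A \<circ> blinfun_apply B)"
    using assms by (intro bij_comp) (auto simp: Aut_cone_def)
  moreover have "(blinfun_apply A \<circ> blinfun_apply B) ` K = K"
    unfolding image_comp[symmetric] using assms by (simp add: Aut_cone_def)
  ultimately show ?thesis by (simp add: Aut_cone_def o_def blinfun_compose.rep_eq)
qed

lemma Aut_cone_adjoint:
  assumes sd: "dual_cone K = K" and A: "A \<in> Aut_cone K"
    and B: "\<And>x y. A x \<bullet> y = x \<bullet> blinfun_apply B y"
  shows "B \<in> Aut_cone K"
proof -
  have adj: "B' x \<in> K" if "A' \<in> Aut_cone K" "\<And>x y. A' x \<bullet> y = x \<bullet> blinfun_apply B' y" "x \<in> K"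
    for A' B' x
  proof -
    have "0 \<le> y \<bullet> B' x" if "y \<in> K" for y
      using Aut_coneD(2)[OF \<open>A' \<in> Aut_cone K\<close> that] \<open>x \<in> K\<close> sd \<open>\<And>x y. A' x \<bullet> y = x \<bullet> B' y\<close>
      unfolding dual_cone_wrt_def by (metis (mono_tags, lifting) mem_Collect_eq)
    then have "B' x \<in> dual_cone K" by (simp add: dual_cone_wrt_def)
    then show ?thesis by (simp add: sd)
  qed
  obtain A' where A': "A' \<in> Aut_cone K" "\<And>x. blinfun_apply A' (A x) = x" "\<And>x. A (blinfun_apply A' x) = x"
    using Aut_cone_inverse[OF A] by metis
  obtain B' where B': "\<And>x y. A' x \<bullet> y = x \<bullet> blinfun_apply B' y"
    using blinfun_adjoint_exists by blast
  have "B' (B x) = x" for x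
  proof -
    have "y \<bullet> B' (B x) = y \<bullet> x" for y by (metis A'(3) B B')
    then show ?thesis by (metis vector_eq_rdot inner_commute)
  qed
  moreover have "B (B' x) = x" for x
  proof -
    have "y \<bullet> B (B' x) = y \<bullet> x" for y by (metis A'(2) B B')
    then show ?thesis by (metis vector_eq_rdot inner_commute)
  qed
  ultimately show ?thesis
    using adj[OF A B] adj[OF A'(1) B'] by (intro Aut_coneI[of B' B]) auto
qed

text \<open>For small \<open>k\<close> both \<open>e + k v\<close> and \<open>e - k v\<close> lie in \<open>K\<close>, hence so do \<open>e + k A v\<close> and \<open>e - k A v\<close>. By self-duality
their inner product, the difference of the squared norms of \<open>e\<close> and of \<open>k A v\<close>, is nonnegative.\<close>

lemma Aut_cone_stabilizer_bounded:
  fixes K :: "'a::euclidean_space set"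
  assumes sd: "dual_cone K = K" and e: "e \<in> interior K"
  obtains C where "\<And>A. A \<in> Aut_cone K \<Longrightarrow> A e = e \<Longrightarrow> norm (blinfun_apply A v) \<le> C"
proof -
  obtain r where r: "r > 0" "cball e r \<subseteq> K" using e mem_interior_cball by blast
  define k where "k = r / (norm v + 1)"
  have nv: "norm v + 1 > 0" using norm_ge_zero[of v] by linarith
  then have k: "k > 0" using r by (simp add: k_def)
  have "k * norm v \<le> r"
    using r nv by (simp add: k_def field_simps)
  then have in_K: "e + k *\<^sub>R v \<in> K" "e - k *\<^sub>R v \<in> K"
    using r k by (auto simp: dist_norm subset_iff)
  have "norm (A v) \<le> norm e / k" if A: "A \<in> Aut_cone K" "A e = e" for A
  proof -
    have "e + k *\<^sub>R A v \<in> K" "e - k *\<^sub>R A v \<in> K"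
      using Aut_coneD(2)[OF A(1)] in_K A(2) by (metis blinfun.add_right blinfun.diff_right blinfun.scaleR_right)+
    then have "0 \<le> (e + k *\<^sub>R A v) \<bullet> (e - k *\<^sub>R A v)"
      using sd unfolding dual_cone_wrt_def by blast
    also have "\<dots> = e \<bullet> e - (k *\<^sub>R A v) \<bullet> (k *\<^sub>R A v)"
    proof -
      have "(e + a) \<bullet> (e - a) = e \<bullet> e - a \<bullet> a" for a
        by (simp add: inner_diff_right inner_add_left inner_commute[of a e])
      then show ?thesis .
    qed
    finally have "norm (k *\<^sub>R A v) \<le> norm e" unfolding norm_le by linarith
    then show ?thesis using k by (simp add: field_simps)
  qed
  then show thesis using that by blast
qed

definition positive_automorphisms :: "'a::euclidean_space set \<Rightarrow> ('a \<Rightarrow>\<^sub>L 'a) set" where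
  "positive_automorphisms K = {T \<in> Aut_cone K. positive_definite T}"

lemma positive_automorphism_inverse:
  assumes T: "T \<in> positive_automorphisms K"
  obtains T' where "T' \<in> positive_automorphisms K" "\<And>x. blinfun_apply T' (T x) = x"
    "\<And>x. T (blinfun_apply T' x) = x"
proof -
  have pd: "positive_definite T" using T by (simp add: positive_automorphisms_def)
  obtain T' where T': "T' \<in> Aut_cone K" "\<And>x. blinfun_apply T' (T x) = x" "\<And>x. T (blinfun_apply T' x) = x"
    using Aut_cone_inverse[of T K] T by (auto simp: positive_automorphisms_def)
  have "T' x \<bullet> y = x \<bullet> T' y" for x y
    by (metis T'(3) self_adjointD[OF positive_definiteD(1)[OF pd]])
  moreover have "0 < T' x \<bullet> x" if "x \<noteq> 0" for x
  proof -
    have "T' x \<noteq> 0" using that T'(3) by (metis blinfun.zero_right)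
    from positive_definiteD(2)[OF pd this] show ?thesis by (simp add: T' inner_commute)
  qed
  ultimately have "T' \<in> positive_automorphisms K"
    using T' by (simp add: positive_automorphisms_def positive_definite_def self_adjoint_def)
  then show thesis using that T' by blast
qed

lemma positive_automorphism_congruence:
  assumes sd: "dual_cone K = K" and T: "T \<in> positive_automorphisms K" and A: "A \<in> Aut_cone K"
    and B: "\<And>x y. A x \<bullet> y = x \<bullet> blinfun_apply B y"
  shows "A o\<^sub>L T o\<^sub>L B \<in> positive_automorphisms K"
proof -
  have BK: "B \<in> Aut_cone K" by (rule Aut_cone_adjoint[OF sd A B])
  have pd: "positive_definite T" and TK: "T \<in> Aut_cone K"
    using T by (auto simp: positive_automorphisms_def)
  have "A (T (B x)) \<bullet> y = x \<bullet> A (T (B y))" for x y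
    using self_adjointD[OF positive_definiteD(1)[OF pd]] B by (metis inner_commute)
  moreover have "0 < A (T (B x)) \<bullet> x" if "x \<noteq> 0" for x
  proof -
    have "B x \<noteq> 0" using that bij_is_inj[OF Aut_coneD(1)[OF BK]] by (metis blinfun.zero_right injD)
    from positive_definiteD(2)[OF pd this] show ?thesis by (simp add: B)
  qed
  ultimately show ?thesis
    using Aut_cone_compose[OF Aut_cone_compose[OF A TK] BK]
    by (simp add: positive_automorphisms_def positive_definite_def self_adjoint_def)
qed

text \<open>The quotient \<open>S\<^sup>-\<^sup>1 T\<close> is positive for the inner product given by \<open>S\<close>, and it fixes \<open>e\<close>, so its powers
lie in the bounded stabilizer of \<open>e\<close>.\<close>

lemma positive_automorphism_unique:
  assumes sd: "dual_cone K = K" and e: "e \<in> interior K"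
    and S: "S \<in> positive_automorphisms K" and T: "T \<in> positive_automorphisms K"
    and eq: "S e = T e"
  shows "S = T"
proof (rule blinfun_eqI)
  fix v
  obtain S' where S': "S' \<in> positive_automorphisms K" "\<And>x. blinfun_apply S' (S x) = x"
    "\<And>x. S (blinfun_apply S' x) = x" using positive_automorphism_inverse[OF S] by metis
  obtain T' where T': "T' \<in> positive_automorphisms K" "\<And>x. blinfun_apply T' (T x) = x"
    "\<And>x. T (blinfun_apply T' x) = x" using positive_automorphism_inverse[OF T] by metis
  have pdS: "positive_definite S" and pdT: "positive_definite T"
    using S T by (auto simp: positive_automorphisms_def)
  define R where "R = S' o\<^sub>L T"
  define R' where "R' = T' o\<^sub>L S"
  have "R \<in> Aut_cone K" "R' \<in> Aut_cone K"
    unfolding R_def R'_def using S S' T T' by (auto simp: positive_automorphisms_def intro: Aut_cone_compose)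
  moreover have "R e = e" "R' e = e" by (simp_all add: R_def R'_def S' T' eq) (simp add: S' eq[symmetric])
  moreover have powers: "\<exists>A\<in>Aut_cone K. blinfun_apply A e = e \<and> blinfun_apply A = blinfun_apply X ^^ n"
    if "X \<in> Aut_cone K" "X e = e" for X n
  proof (induction n)
    case 0
    have "id_blinfun \<in> Aut_cone K" by (rule Aut_coneI[of id_blinfun]) auto
    then show ?case by (intro bexI[of _ id_blinfun]) auto
  next
    case (Suc n)
    then obtain A where A: "A \<in> Aut_cone K" "A e = e" "blinfun_apply A = blinfun_apply X ^^ n" by blast
    have "X o\<^sub>L A \<in> Aut_cone K" by (rule Aut_cone_compose[OF that(1) A(1)])
    then show ?case using A that(2) by (intro bexI[of _ "X o\<^sub>L A"]) (simp_all add: blinfun_compose.rep_eq)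
  qed
  obtain C where C: "\<And>A. A \<in> Aut_cone K \<Longrightarrow> A e = e \<Longrightarrow> norm (blinfun_apply A v) \<le> C"
    using Aut_cone_stabilizer_bounded[OF sd e] by blast
  ultimately have bdd: "norm ((blinfun_apply R ^^ n) v) \<le> C" "norm ((blinfun_apply R' ^^ n) v) \<le> C" for n
    using powers[of R n] powers[of R' n] by metis+
  have "R v = v"
  proof (rule power_bounded_positive_imp_identity[OF pdS])
    show "S (R u) \<bullet> w = S u \<bullet> R w" for u w
      using self_adjointD[OF positive_definiteD(1)[OF pdS]] self_adjointD[OF positive_definiteD(1)[OF pdT]]
      by (simp add: R_def S')
    show "0 < S (R u) \<bullet> u" if "u \<noteq> 0" for u
      using positive_definiteD(2)[OF pdT that] by (simp add: R_def S')
    show "R' (R u) = u" "R (R' u) = u" for u by (simp_all add: R_def R'_def S' T')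
  qed (rule bdd)+
  then show "S v = T v" by (metis R_def S'(3) blinfun_apply_blinfun_compose)
qed

section \<open>Barriers normalized at a point\<close>

lemma convex_on_above_tangent:
  fixes F :: "'a::euclidean_space \<Rightarrow> real"
  assumes cv: "convex_on S F" and wx: "w \<in> S" "x \<in> S"
    and d: "(F has_derivative D) (at w)"
  shows "F w + D (x - w) \<le> F x"
proof (rule ccontr)
  assume neg: "\<not> ?thesis"
  define \<epsilon> where "\<epsilon> = (D (x - w) - (F x - F w)) / (2 * (norm (x - w) + 1))"
  have n1: "norm (x - w) + 1 > 0" using norm_ge_zero[of "x - w"] by linarith
  then have \<epsilon>: "\<epsilon> > 0" using neg by (simp add: \<epsilon>_def)
  obtain \<delta> where \<delta>: "\<delta> > 0"
    "\<And>y. norm (y - w) < \<delta> \<Longrightarrow> norm (F y - F w - D (y - w)) \<le> \<epsilon> * norm (y - w)"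
    using d \<epsilon> unfolding has_derivative_at_alt by blast
  define t where "t = min 1 (\<delta> / (2 * (norm (x - w) + 1)))"
  have t: "0 < t" "t \<le> 1" using \<delta> n1 by (auto simp: t_def)
  have "t * (norm (x - w) + 1) \<le> \<delta> / 2"
  proof -
    have "t \<le> \<delta> / (2 * (norm (x - w) + 1))" by (simp add: t_def)
    then show ?thesis using n1 by (simp add: field_simps)
  qed
  then have "t * norm (x - w) < \<delta>" using t \<delta>(1) by (simp add: algebra_simps)
  then have "norm (F (w + t *\<^sub>R (x - w)) - F w - D (t *\<^sub>R (x - w))) \<le> \<epsilon> * norm (t *\<^sub>R (x - w))"
    using \<delta>(2)[of "w + t *\<^sub>R (x - w)"] t by simp
  moreover have "D (t *\<^sub>R (x - w)) = t * D (x - w)"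
    using has_derivative_linear[OF d] by (simp add: linear_scale)
  ultimately have 1: "F (w + t *\<^sub>R (x - w)) \<ge> F w + t * D (x - w) - t * (\<epsilon> * norm (x - w))"
    using t by (simp only: norm_scaleR real_norm_def abs_le_iff) (simp add: mult.left_commute)
  have "F ((1 - t) *\<^sub>R w + t *\<^sub>R x) \<le> (1 - t) * F w + t * F x"
    using convex_onD[OF cv, of t w x] t wx by simp
  moreover have "(1 - t) *\<^sub>R w + t *\<^sub>R x = w + t *\<^sub>R (x - w)" by (simp add: algebra_simps)
  ultimately have "t * (D (x - w) - \<epsilon> * norm (x - w)) \<le> t * (F x - F w)"
    using 1 by (simp add: algebra_simps)
  then have "D (x - w) - (F x - F w) \<le> \<epsilon> * norm (x - w)" using t by simp
  also have "\<dots> \<le> \<epsilon> * (norm (x - w) + 1)" using \<epsilon> by simp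
  also have "\<dots> = (D (x - w) - (F x - F w)) / 2"
  proof -
    have "c / (2 * n) * n = c / 2" if "n > 0" for c n :: real using that by simp
    from this[OF n1] show ?thesis unfolding \<epsilon>_def .
  qed
  finally show False using neg by simp
qed

text \<open>The properties of a self-scaled barrier used below, with \<open>g\<close>, \<open>P\<close>, \<open>Q\<close> its first three derivatives. The
conjugate barrier is eliminated: the duality relation at \<open>w = e\<close> expresses it through \<open>F\<close>, and
inserting this into the relation for general \<open>w\<close> leaves the last assumption.\<close>

locale self_scaled_jet =
  fixes K :: "'a::euclidean_space set" and F :: "'a \<Rightarrow> real" and g :: "'a \<Rightarrow> 'a"
    and P :: "'a \<Rightarrow> 'a \<Rightarrow>\<^sub>L 'a" and Q :: "'a \<Rightarrow> 'a \<Rightarrow>\<^sub>L 'a \<Rightarrow>\<^sub>L 'a" and \<nu> :: real and e :: 'a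
  assumes self_dual: "dual_cone K = K"
    and jet: "third_order_jet (interior K) F g P Q"
    and e_interior: "e \<in> interior K" and P_e: "P e = id_blinfun"
    and homogeneous: "\<And>x t. x \<in> interior K \<Longrightarrow> t > 0 \<Longrightarrow> F (t *\<^sub>R x) = F x - \<nu> * ln t"
    and convex_F: "convex_on (interior K) F"
    and barrier: "\<And>X z. (\<And>k::nat. X k \<in> interior K) \<Longrightarrow> z \<in> frontier K \<Longrightarrow> X \<longlonglongrightarrow> z
           \<Longrightarrow> filterlim (\<lambda>k. F (X k)) at_top sequentially"
    and P_nonneg: "\<And>x h. x \<in> interior K \<Longrightarrow> 0 \<le> P x h \<bullet> h"
    and P_bij: "\<And>x. x \<in> interior K \<Longrightarrow> bij (blinfun_apply (P x))"
    and P_interior: "\<And>x w. x \<in> interior K \<Longrightarrow> w \<in> interior K \<Longrightarrow> P w x \<in> interior K"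
    and F_P: "\<And>x w. x \<in> interior K \<Longrightarrow> w \<in> interior K \<Longrightarrow> F (P w x) = F x - 2 * F w + 2 * F e"
begin

lemmas P_symmetric = third_order_jet_symmetric(1)[OF jet]
  and Q_symmetric = third_order_jet_symmetric(2,3)[OF jet]

lemma K_iff: "s \<in> K \<longleftrightarrow> (\<forall>x\<in>K. 0 \<le> x \<bullet> s)"
  using self_dual unfolding dual_cone_wrt_def by blast

lemma K_add: "x \<in> K \<Longrightarrow> y \<in> K \<Longrightarrow> x + y \<in> K"
  and K_scale: "t \<ge> 0 \<Longrightarrow> x \<in> K \<Longrightarrow> t *\<^sub>R x \<in> K"
  by (simp_all add: K_iff[of "x + y"] K_iff[of "t *\<^sub>R x"] K_iff[of x] K_iff[of y] inner_add_right)

lemma convex_K: "convex K"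
  by (simp add: convex_def K_add K_scale)

lemma closed_K: "closed K"
proof -
  have "K = (\<Inter>x\<in>K. {s. 0 \<le> x \<bullet> s})" using K_iff by blast
  also have "closed \<dots>" by (intro closed_INT ballI closed_Collect_le continuous_intros)
  finally show ?thesis .
qed

lemma interior_in_K: "x \<in> interior K \<Longrightarrow> x \<in> K"
  using interior_subset by blast

lemma interior_scale: "t > 0 \<Longrightarrow> x \<in> interior K \<Longrightarrow> t *\<^sub>R x \<in> interior K"
  by (rule interior_closed_under_scaling) (simp_all add: K_scale)

lemma interior_add: "x \<in> K \<Longrightarrow> y \<in> interior K \<Longrightarrow> x + y \<in> interior K"
proof -
  assume x: "x \<in> K" and y: "y \<in> interior K"
  have "(\<lambda>z. x + z) ` interior K \<subseteq> K" using K_add[OF x] interior_in_K by blast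
  then have "(\<lambda>z. x + z) ` interior K \<subseteq> interior K"
    by (rule interior_maximal) (rule open_translation, rule open_interior)
  then show ?thesis using y by blast
qed

lemma g_inner: "x \<in> interior K \<Longrightarrow> g x \<bullet> x = - \<nu>"
  and P_self: "x \<in> interior K \<Longrightarrow> P x x = - g x"
  and Q_self: "x \<in> interior K \<Longrightarrow> Q x x = - 2 *\<^sub>R P x"
  by (rule logarithmically_homogeneous_jet[OF jet _ homogeneous], assumption?, rule interior_scale, assumption+)+

lemma P_positive_definite:
  assumes x: "x \<in> interior K"
  shows "positive_definite (P x)"
proof -
  have "0 < P x h \<bullet> h" if h: "h \<noteq> 0" for h
  proof (rule ccontr)
    assume "\<not> ?thesis"
    then have 0: "P x h \<bullet> h = 0" using P_nonneg[OF x, of h] by linarith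
    have "P x h = 0"
      by (rule nonneg_form_null_vector[OF blinfun_linear subspace_UNIV _ _ _ _ 0])
        (use P_symmetric[OF x] P_nonneg[OF x] in auto)
    then show False using h bij_is_inj[OF P_bij[OF x]] by (metis blinfun.zero_right injD)
  qed
  then show ?thesis using P_symmetric[OF x] by (auto simp: positive_definite_def self_adjoint_def)
qed

text \<open>The image is open. It is also closed in the interior: if \<open>P w x\<close> is interior for a boundary point \<open>x\<close> of
\<open>K\<close>, then along interior points tending to \<open>x\<close> the value \<open>F\<close> tends to infinity, while
\<open>F (P w x) = F x - 2 F w + 2 F e\<close> says that it stays bounded.\<close>

lemma P_image_interior:
  assumes w: "w \<in> interior K"
  shows "blinfun_apply (P w) ` interior K = interior K"
proof -
  obtain B where B: "\<And>x. blinfun_apply B (P w x) = x" "\<And>x. P w (blinfun_apply B x) = x"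
    using blinfun_inverse_exists[OF P_bij[OF w]] by blast
  have B_interior: "B y \<in> interior K" if y: "y \<in> interior K" and By: "B y \<in> K" for y
  proof (rule ccontr)
    assume "B y \<notin> interior K"
    then have fr: "B y \<in> frontier K" using By closed_K by (simp add: frontier_def)
    \<comment> \<open>Interior points approaching the boundary point \<open>B y\<close> along the direction \<open>e\<close>.\<close>
    define X where "X k = B y + inverse (real (Suc k)) *\<^sub>R e" for k
    have X: "X k \<in> interior K" for k
      unfolding X_def by (intro interior_add By interior_scale e_interior) simp
    have "(\<lambda>k. B y + inverse (real (Suc k)) *\<^sub>R e) \<longlonglongrightarrow> B y + 0 *\<^sub>R e"
      by (intro tendsto_intros LIMSEQ_inverse_real_of_nat)
    then have lim: "X \<longlonglongrightarrow> B y" by (simp add: X_def[abs_def])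
    have "filterlim (\<lambda>k. F (X k)) at_top sequentially" by (rule barrier[OF X fr lim])
    moreover have "(\<lambda>k. F (X k)) \<longlonglongrightarrow> F y + 2 * F w - 2 * F e"
    proof -
      have "(\<lambda>k. P w (X k)) \<longlonglongrightarrow> y"
        using blinfun.tendsto[OF tendsto_const lim, of "P w"] by (simp add: B(2))
      moreover have "isCont F y"
        using third_order_jetD(2)[OF jet y] has_derivative_continuous by blast
      ultimately have "(\<lambda>k. F (P w (X k))) \<longlonglongrightarrow> F y" using isCont_tendsto_compose by blast
      then have "(\<lambda>k. F (P w (X k)) + 2 * F w - 2 * F e) \<longlonglongrightarrow> F y + 2 * F w - 2 * F e"
        by (intro tendsto_intros)
      then show ?thesis using F_P[OF X w] by simp
    qed
    ultimately show False
      using not_tendsto_and_filterlim_at_infinity[OF sequentially_bot]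
        filterlim_at_top_imp_at_infinity[of "\<lambda>k. F (X k)"] by metis
  qed
  define T where "T = interior K \<inter> blinfun_apply B -` K"
  have T: "T = blinfun_apply (P w) ` interior K"
  proof (intro set_eqI iffI)
    fix y assume "y \<in> T"
    then have "B y \<in> interior K" using B_interior by (simp add: T_def)
    then show "y \<in> blinfun_apply (P w) ` interior K" using B(2) by (metis image_eqI)
  next
    fix y assume "y \<in> blinfun_apply (P w) ` interior K"
    then show "y \<in> T" using P_interior[OF _ w] interior_in_K by (auto simp: T_def B)
  qed
  have "connected (interior K)" by (intro convex_connected convex_interior convex_K)
  moreover have "openin (top_of_set (interior K)) T"
  proof (rule open_openin_trans)
    show "open T"
      unfolding T using P_bij[OF w] blinfun_linear
      by (intro open_surjective_linear_image open_interior) (auto simp: bij_is_surj)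
  qed (auto simp: T_def)
  moreover have "closedin (top_of_set (interior K)) T"
    unfolding T_def by (intro continuous_closedin_preimage continuous_intros closed_K)
  moreover have "T \<noteq> {}" unfolding T using e_interior by blast
  ultimately show ?thesis unfolding T[symmetric] using connected_clopen by metis
qed

lemma P_positive_automorphism:
  assumes w: "w \<in> interior K"
  shows "P w \<in> positive_automorphisms K"
proof -
  have "closure (interior K) = K"
    using convex_closure_interior[OF convex_K] e_interior closed_K by auto
  then have "blinfun_apply (P w) ` K = K"
    using closure_injective_linear_image[OF blinfun_linear bij_is_inj[OF P_bij[OF w]], of "interior K"]
    by (simp add: P_image_interior[OF w])
  then show ?thesis
    using P_bij[OF w] P_positive_definite[OF w] by (simp add: positive_automorphisms_def Aut_cone_def)
qed

text \<open>The equation \<open>P w x = s\<close> is the critical point equation of \<open>\<phi> w = s \<bullet> w - g w \<bullet> x\<close>. Both summands are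
nonnegative, as \<open>- g w = P w w\<close> lies in \<open>K\<close>; the first one bounds the sublevel sets, and the second one
tends to infinity at the boundary because convexity gives \<open>- g w \<bullet> x \<ge> F w + \<nu> - F x\<close>. So \<open>\<phi>\<close>
attains its minimum in the interior.\<close>

lemma scaling_point_exists:
  assumes x: "x \<in> interior K" and s: "s \<in> interior K"
  obtains w where "w \<in> interior K" "P w x = s"
proof -
  define \<phi> where "\<phi> w = s \<bullet> w - g w \<bullet> x" for w
  have sw: "0 \<le> s \<bullet> w" if "w \<in> K" for w
    using that interior_in_K[OF s] K_iff by blast
  have gx: "0 \<le> - (g w \<bullet> x)" if w: "w \<in> interior K" for w
  proof -
    have "- g w \<in> K" using P_interior[OF w w] P_self[OF w] interior_in_K by metis
    then show ?thesis using interior_in_K[OF x] K_iff by (metis inner_minus_left)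
  qed
  have d\<phi>: "(\<phi> has_derivative (\<lambda>h. s \<bullet> h - P w h \<bullet> x)) (at w)" if w: "w \<in> interior K" for w
    unfolding \<phi>_def
    by (intro derivative_intros has_derivative_inner_left third_order_jetD(3)[OF jet w])
  define L where "L = {w \<in> interior K. \<phi> w \<le> \<phi> e}"
  obtain r where r: "r > 0" "cball s r \<subseteq> K" using s mem_interior_cball by blast
  have lower: "r * norm w \<le> s \<bullet> w" if w: "w \<in> K" for w
  proof (cases "w = 0")
    case False
    have "s - (r / norm w) *\<^sub>R w \<in> K" using r False by (auto simp: subset_iff dist_norm)
    then have "0 \<le> w \<bullet> (s - (r / norm w) *\<^sub>R w)" using w K_iff by blast
    also have "\<dots> = s \<bullet> w - r * norm w"
      using False by (simp add: inner_diff_right inner_commute dot_square_norm power2_eq_square)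
    finally show ?thesis by simp
  qed simp
  have "bounded L"
  proof (rule boundedI)
    fix w assume "w \<in> L"
    then have w: "w \<in> interior K" "\<phi> w \<le> \<phi> e" by (auto simp: L_def)
    then have "r * norm w \<le> \<phi> e" using lower[OF interior_in_K[OF w(1)]] gx[OF w(1)] by (simp add: \<phi>_def)
    then show "norm w \<le> \<phi> e / r" using r by (simp add: field_simps)
  qed
  moreover have "closed L"
    unfolding closed_sequential_limits
  proof (intro allI impI, elim conjE)
    fix X w assume X: "\<forall>k. X k \<in> L" and lim: "X \<longlonglongrightarrow> w"
    have Xi: "X k \<in> interior K" and X\<phi>: "\<phi> (X k) \<le> \<phi> e" for k using X by (auto simp: L_def)
    have wK: "w \<in> K" using closed_sequentially[OF closed_K _ lim] Xi interior_in_K by blast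
    have "w \<in> interior K"
    proof (rule ccontr)
      assume "w \<notin> interior K"
      then have "w \<in> frontier K" using wK closed_K by (simp add: frontier_def)
      then have "filterlim (\<lambda>k. F (X k)) at_top sequentially" using barrier Xi lim by blast
      then have "eventually (\<lambda>k. \<phi> e - \<nu> + F x < F (X k)) sequentially"
        unfolding filterlim_at_top_dense by blast
      then obtain k where k: "\<phi> e - \<nu> + F x < F (X k)" using eventually_happens by fastforce
      have "F (X k) + g (X k) \<bullet> (x - X k) \<le> F x"
        by (rule convex_on_above_tangent[OF convex_F Xi x third_order_jetD(2)[OF jet Xi]])
      then have "F (X k) + \<nu> - F x \<le> - (g (X k) \<bullet> x)"
        using g_inner[OF Xi, of k] by (simp add: inner_diff_right)
      then have "F (X k) + \<nu> - F x \<le> \<phi> (X k)"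
        using sw[OF interior_in_K[OF Xi, of k]] by (simp add: \<phi>_def)
      then show False using k X\<phi>[of k] by linarith
    qed
    moreover from this have "(\<lambda>k. \<phi> (X k)) \<longlonglongrightarrow> \<phi> w"
      using isCont_tendsto_compose[OF has_derivative_continuous[OF d\<phi>] lim] by blast
    then have "\<phi> w \<le> \<phi> e" by (rule LIMSEQ_le_const2) (use X\<phi> in blast)
    ultimately show "w \<in> L" by (simp add: L_def)
  qed
  ultimately have "compact L" using compact_eq_bounded_closed by blast
  moreover have "L \<noteq> {}" using e_interior by (auto simp: L_def)
  moreover have "continuous_on L \<phi>"
    by (rule continuous_at_imp_continuous_on) (auto simp: L_def intro: has_derivative_continuous[OF d\<phi>])
  ultimately obtain w where w: "w \<in> L" and min: "\<forall>y\<in>L. \<phi> w \<le> \<phi> y"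
    using continuous_attains_inf by blast
  have wi: "w \<in> interior K" using w by (simp add: L_def)
  have "\<forall>y\<in>interior K. \<phi> w \<le> \<phi> y" using min w unfolding L_def by force
  then have "(\<lambda>h. s \<bullet> h - P w h \<bullet> x) = (\<lambda>h. 0)"
    using differential_zero_maxmin[OF wi open_interior d\<phi>[OF wi]] by blast
  then have "s \<bullet> h = P w x \<bullet> h" for h
    by (metis (no_types) P_symmetric[OF wi] eq_iff_diff_eq_0 inner_commute)
  then have "P w x = s" by (metis vector_eq_rdot)
  then show thesis using that wi by blast
qed

text \<open>Choose \<open>w\<close> with \<open>P w e = T e\<close> and use that both operators are determined by this value.\<close>

lemma positive_automorphism_is_hessian:
  assumes T: "T \<in> positive_automorphisms K"
  obtains w where "w \<in> interior K" "T = P w"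
proof -
  have "T e \<in> interior K"
    using T Aut_coneD(4)[OF _ e_interior] by (simp add: positive_automorphisms_def)
  then obtain w where w: "w \<in> interior K" "P w e = T e" using scaling_point_exists[OF e_interior] by blast
  then have "P w = T"
    using positive_automorphism_unique[OF self_dual e_interior P_positive_automorphism T] by blast
  then show thesis using that w by blast
qed

lemma F_positive_automorphism:
  assumes T: "T \<in> positive_automorphisms K"
  obtains c where "\<And>x. x \<in> interior K \<Longrightarrow> F (T x) = F x + c"
proof -
  obtain w where w: "w \<in> interior K" "T = P w" using positive_automorphism_is_hessian[OF T] by blast
  have "F (T x) = F x + (2 * F e - 2 * F w)" if "x \<in> interior K" for x
    using F_P[OF that w(1)] w(2) by simp
  then show thesis using that by blast
qed

lemma jet_invariant_under:
  assumes T: "T \<in> positive_automorphisms K"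
    and f: "third_order_jet (interior K) f f1 f2 f3"
    and eq: "\<And>x. x \<in> interior K \<Longrightarrow> f (T x) = f x + c" and x: "x \<in> interior K"
  shows "T (f2 (T x) (T u)) = f2 x u"
proof -
  have sa: "\<And>x y. T x \<bullet> y = x \<bullet> T y" and Ti: "\<And>x. x \<in> interior K \<Longrightarrow> T x \<in> interior K"
    using T Aut_coneD(4)[of T K] by (auto simp: positive_automorphisms_def positive_definite_def self_adjoint_def)
  obtain f3' where "third_order_jet (interior K) (\<lambda>x. f (T x)) (\<lambda>x. T (f1 (T x)))
      (\<lambda>x. T o\<^sub>L f2 (T x) o\<^sub>L T) f3'"
    by (rule third_order_jet_compose_linear[OF f Ti sa])
  from third_order_jet_unique(2)[OF f this eq x]
  have "(T o\<^sub>L f2 (T x) o\<^sub>L T) u = f2 x u" by simp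
  then show ?thesis by simp
qed

lemma P_invariant:
  assumes T: "T \<in> positive_automorphisms K" and x: "x \<in> interior K"
  shows "T (P (T x) (T u)) = P x u"
  using F_positive_automorphism[OF T] jet_invariant_under[OF T jet _ x] by metis

lemma neg_g_interior: "x \<in> interior K \<Longrightarrow> - g x \<in> interior K"
  using P_self P_interior by metis

text \<open>Since \<open>P x x = - g x\<close>, this is the invariance of the Hessian under \<open>T = P x\<close> at the point \<open>x\<close> itself.\<close>

lemma P_neg_g_inverse:
  assumes x: "x \<in> interior K"
  shows "P (- g x) (P x u) = u" "P x (P (- g x) u) = u"
proof -
  have inj: "P x a = P x b \<Longrightarrow> a = b" for a b using bij_is_inj[OF P_bij[OF x]] by (metis injD)
  have left: "P (- g x) (P x u) = u" for u
  proof (rule inj)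
    show "P x (P (- g x) (P x u)) = P x u"
      using P_invariant[OF P_positive_automorphism[OF x] x, of u] by (simp add: P_self[OF x])
  qed
  then show "P (- g x) (P x u) = u" .
  obtain v where "u = P x v" using bij_is_surj[OF P_bij[OF x]] by (metis surjE)
  then show "P x (P (- g x) u) = u" using left by simp
qed

end

section \<open>Invariant functions and the commutant of the Hessians\<close>

context self_scaled_jet begin

definition commutant :: "('a \<Rightarrow>\<^sub>L 'a) set" where
  "commutant = {Z. \<forall>x\<in>interior K. \<forall>u. blinfun_apply Z (P x u) = P x (Z u)}"

lemma commutantD: "Z \<in> commutant \<Longrightarrow> x \<in> interior K \<Longrightarrow> Z (P x u) = P x (Z u)"
  by (simp add: commutant_def)

lemma Q_e_left: "Q e e u = - 2 *\<^sub>R u"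
  by (simp add: Q_self[OF e_interior] P_e blinfun.scaleR_left blinfun.minus_left)

lemma Q_e_right: "Q e h e = - 2 *\<^sub>R h"
  using Q_symmetric(2)[OF e_interior, of h e] Q_e_left by simp

text \<open>Differentiate \<open>Z (P x u) = P x (Z u)\<close> at \<open>e\<close>. In terms of the commutative product given by \<open>- Q e / 2\<close>, whose unit
is \<open>e\<close>, the second identity says that \<open>Z\<close> is multiplication by \<open>Z e\<close>.\<close>

lemma commutant_Q:
  assumes Z: "Z \<in> commutant"
  shows "Z (Q e h u) = Q e h (Z u)" and "- 2 *\<^sub>R Z h = Q e (Z e) h"
proof -
  have dP: "((\<lambda>y. P y v) has_derivative (\<lambda>h. Q e h v)) (at e)" for v
    using third_order_jetD(4)[OF jet e_interior]
    by (rule bounded_linear.has_derivative[OF blinfun.bounded_linear_left])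
  have "((\<lambda>y. Z (P y u)) has_derivative (\<lambda>h. Z (Q e h u))) (at e)" for u
    by (rule bounded_linear.has_derivative[OF blinfun.bounded_linear_right dP])
  from has_derivative_eq_on_open[OF open_interior e_interior this dP] commutantD[OF Z]
  have *: "Z (Q e h u) = Q e h (Z u)" for h u by metis
  then show "Z (Q e h u) = Q e h (Z u)" .
  have "Z (Q e h e) = Q e (Z e) h" using * Q_symmetric(2)[OF e_interior] by metis
  then show "- 2 *\<^sub>R Z h = Q e (Z e) h"
    by (simp add: Q_e_right blinfun.scaleR_right blinfun.minus_right)
qed

lemma commutant_self_adjoint:
  assumes Z: "Z \<in> commutant"
  shows "self_adjoint Z"
proof -
  have "(- 2 *\<^sub>R Z x) \<bullet> y = x \<bullet> (- 2 *\<^sub>R Z y)" for x y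
    unfolding commutant_Q(2)[OF Z] by (rule Q_symmetric(1)[OF e_interior])
  then show ?thesis by (simp add: self_adjoint_def)
qed

lemma commutant_commutative:
  assumes Z: "Z \<in> commutant" and Z': "Z' \<in> commutant"
  shows "Z (Z' u) = Z' (Z u)"
proof -
  have "- 2 *\<^sub>R Z' (Z u) = Z' (- 2 *\<^sub>R Z u)" by (simp only: blinfun.scaleR_right)
  also have "\<dots> = Z' (Q e (Z e) u)" by (simp only: commutant_Q(2)[OF Z])
  also have "\<dots> = - 2 *\<^sub>R Z (Z' u)" by (simp only: commutant_Q[OF Z'] commutant_Q(2)[OF Z])
  finally show ?thesis by simp
qed

text \<open>For a positive automorphism \<open>T\<close>, and \<open>C\<close> the adjoint of \<open>A\<close>, both \<open>A T C\<close> and \<open>A C\<close> are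
positive automorphisms, hence commute with \<open>Z\<close>; so does \<open>A T A\<^sup>-\<^sup>1 = (A T C) (A C)\<^sup>-\<^sup>1\<close>.\<close>

lemma commutant_conjugate:
  assumes Z: "Z \<in> commutant" and A: "A \<in> Aut_cone K"
    and B: "\<And>x. blinfun_apply B (A x) = x" "\<And>x. A (blinfun_apply B x) = x"
  shows "B o\<^sub>L Z o\<^sub>L A \<in> commutant"
proof -
  obtain C where C: "\<And>x y. A x \<bullet> y = x \<bullet> blinfun_apply C y" using blinfun_adjoint_exists by blast
  have CK: "C \<in> Aut_cone K" by (rule Aut_cone_adjoint[OF self_dual A C])
  have comm: "Z (A (T (C u))) = A (T (C (Z u)))" if T: "T \<in> positive_automorphisms K" for T u
  proof -
    obtain w where w: "w \<in> interior K" "A o\<^sub>L T o\<^sub>L C = P w"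
      using positive_automorphism_is_hessian[OF positive_automorphism_congruence[OF self_dual T A C]] by blast
    have "Z ((A o\<^sub>L T o\<^sub>L C) u) = (A o\<^sub>L T o\<^sub>L C) (Z u)" unfolding w(2) by (rule commutantD[OF Z w(1)])
    then show ?thesis by simp
  qed
  have idp: "id_blinfun \<in> positive_automorphisms K"
    using P_positive_automorphism[OF e_interior] by (simp add: P_e)
  have "B (Z (A (P x u))) = P x (B (Z (A u)))" if x: "x \<in> interior K" for x u
  proof -
    obtain y where y: "u = C y" using bij_is_surj[OF Aut_coneD(1)[OF CK]] by (metis surjE)
    show ?thesis
      using comm[OF P_positive_automorphism[OF x], of y] comm[OF idp, of y] by (simp add: y B)
  qed
  then show ?thesis by (simp add: commutant_def)
qed

text \<open>Put \<open>S = f2 e\<close>, \<open>q = Q e\<close>, \<open>r = f3 e\<close>. Differentiating the invariance \<open>P w \<circ> f2 (P w e) \<circ> P w = S\<close> at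
\<open>w = e\<close> gives \<open>2 r h = S q h + q h S\<close>, and the symmetry of \<open>q\<close> and \<open>r\<close> then forces \<open>S\<close> to commute with every \<open>q h\<close>.
Consequently \<open>\<Phi> y = (P y)\<^sup>-\<^sup>1 f2 y\<close> has derivative zero at \<open>e\<close>. Positive automorphisms transport
\<open>\<Phi>\<close> by conjugation and move \<open>e\<close> to every interior point, so \<open>\<Phi>\<close> is constant.\<close>

lemma invariant_function_hessian:
  assumes f: "third_order_jet (interior K) f f1 f2 f3"
    and hom: "\<And>x t. x \<in> interior K \<Longrightarrow> t > 0 \<Longrightarrow> f (t *\<^sub>R x) = f x - \<mu> * ln t"
    and inv: "\<And>T. T \<in> positive_automorphisms K \<Longrightarrow> \<exists>c. \<forall>x\<in>interior K. f (T x) = f x + c"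
  shows "x \<in> interior K \<Longrightarrow> f2 x u = P x (f2 e u)" and "f2 e \<in> commutant"
proof -
  define S where "S = f2 e"
  define r where "r = f3 e"
  define q where "q = Q e"
  have f2_inv: "T (f2 (T x) (T u)) = f2 x u" if T: "T \<in> positive_automorphisms K" and x: "x \<in> interior K" for T x u
  proof -
    obtain c where "\<And>x. x \<in> interior K \<Longrightarrow> f (T x) = f x + c" using inv[OF T] by blast
    from jet_invariant_under[OF T f this x] show ?thesis .
  qed
  have df2: "(f2 has_derivative blinfun_apply r) (at e)"
    using third_order_jetD(4)[OF f e_interior] by (simp add: r_def)
  have dP: "(P has_derivative blinfun_apply q) (at e)"
    using third_order_jetD(4)[OF jet e_interior] by (simp add: q_def)
  have q_sa: "q h u \<bullet> v = u \<bullet> q h v" and q_comm: "q h u = q u h" for h u v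
    using Q_symmetric[OF e_interior] by (simp_all add: q_def)
  have S_sa: "S u \<bullet> v = u \<bullet> S v" and r_comm: "r h u = r u h" for h u v
    using third_order_jet_symmetric[OF f e_interior] by (simp_all add: S_def r_def)
  have q_e: "q h e = - 2 *\<^sub>R h" for h using Q_e_right by (simp add: q_def)
  have r_e: "r e u = - 2 *\<^sub>R S u" for u
    using logarithmically_homogeneous_jet(3)[OF f interior_scale hom e_interior]
    by (simp add: r_def S_def blinfun.scaleR_left blinfun.minus_left)
  have Sqr: "2 *\<^sub>R r h u = S (q h u) + q h (S u)" for h u
  proof -
    have dPe: "((\<lambda>w. P w e) has_derivative (\<lambda>h. q h e)) (at e)"
      using dP by (rule bounded_linear.has_derivative[OF blinfun.bounded_linear_left])
    have "(f2 has_derivative blinfun_apply r) (at (P e e))" using df2 by (simp add: P_e)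
    from has_derivative_compose[OF dPe this]
    have dfP: "((\<lambda>w. f2 (P w e)) has_derivative (\<lambda>h. r (q h e))) (at e)" .
    have "((\<lambda>w. P w o\<^sub>L (f2 (P w e) o\<^sub>L P w)) has_derivative
       (\<lambda>h. (P e o\<^sub>L ((f2 (P e e) o\<^sub>L q h) + (r (q h e) o\<^sub>L P e))) + (q h o\<^sub>L (f2 (P e e) o\<^sub>L P e)))) (at e)"
      using bounded_bilinear.FDERIV[OF bounded_bilinear_blinfun_compose dP
          bounded_bilinear.FDERIV[OF bounded_bilinear_blinfun_compose dfP dP]] .
    moreover have "((\<lambda>w. S) has_derivative (\<lambda>h. 0)) (at e)" by simp
    moreover have "P w o\<^sub>L (f2 (P w e) o\<^sub>L P w) = S" if "w \<in> interior K" for w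
      using f2_inv[OF P_positive_automorphism[OF that] e_interior] by (intro blinfun_eqI) (simp add: S_def)
    ultimately have "(\<lambda>h. (P e o\<^sub>L ((f2 (P e e) o\<^sub>L q h) + (r (q h e) o\<^sub>L P e))) + (q h o\<^sub>L (f2 (P e e) o\<^sub>L P e))) = (\<lambda>h. 0)"
      by (rule has_derivative_eq_on_open[OF open_interior e_interior])
    from fun_cong[OF this, of h]
    have "((P e o\<^sub>L ((f2 (P e e) o\<^sub>L q h) + (r (q h e) o\<^sub>L P e))) + (q h o\<^sub>L (f2 (P e e) o\<^sub>L P e))) u = 0"
      by simp
    then show ?thesis
      by (simp add: P_e S_def[symmetric] q_e blinfun.add_left blinfun.scaleR_right blinfun.scaleR_left
          blinfun.minus_left blinfun.minus_right algebra_simps add_eq_0_iff2)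
  qed
  \<comment> \<open>In \<open>Sqr\<close> the left side and \<open>S (q h u)\<close> are symmetric in \<open>h\<close> and \<open>u\<close>, hence so is the remaining term.\<close>
  have "q h (S u) = q u (S h)" for h u
    using Sqr[of h u] Sqr[of u h] r_comm[of h u] q_comm[of h u] by simp
  then have qS: "q h (S u) = q (S h) u" for h u using q_comm by metis
  \<comment> \<open>By \<open>qS\<close>, \<open>q h \<circ> S = q (S h)\<close> is self-adjoint, so it equals its adjoint \<open>S \<circ> q h\<close>.\<close>
  have Sq: "S (q h u) = q h (S u)" for h u
  proof -
    have "S (q h u) \<bullet> v = q h (S u) \<bullet> v" for v
      by (metis S_sa q_sa qS)
    then show ?thesis by (metis vector_eq_rdot)
  qed
  have rq: "r h u = q h (S u)" for h u
  proof -
    have "2 *\<^sub>R r h u = 2 *\<^sub>R q h (S u)" using Sqr[of h u] Sq by (simp add: scaleR_2)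
    then show ?thesis by simp
  qed
  define \<Phi> where "\<Phi> y = P (- g y) o\<^sub>L f2 y" for y
  have P_\<Phi>: "P y (\<Phi> y u) = f2 y u" if "y \<in> interior K" for y u
    using P_neg_g_inverse(2)[OF that] by (simp add: \<Phi>_def)
  have g_e: "- g e = e" using P_self[OF e_interior] by (simp add: P_e)
  have d\<Phi>_e: "(\<Phi> has_derivative (\<lambda>h. 0)) (at e)"
  proof -
    have dg: "((\<lambda>y. - g y) has_derivative (\<lambda>h. - h)) (at e)"
      using has_derivative_minus[OF third_order_jetD(3)[OF jet e_interior]] by (simp add: P_e)
    have "(P has_derivative blinfun_apply q) (at (- g e))" using dP by (simp add: g_e)
    from has_derivative_compose[OF dg this]
    have "((\<lambda>y. P (- g y)) has_derivative (\<lambda>h. q (- h))) (at e)" .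
    from bounded_bilinear.FDERIV[OF bounded_bilinear_blinfun_compose this df2]
    have "(\<Phi> has_derivative (\<lambda>h. (P (- g e) o\<^sub>L r h) + (q (- h) o\<^sub>L f2 e))) (at e)"
      by (simp add: \<Phi>_def[abs_def])
    moreover have "(P (- g e) o\<^sub>L r h) + (q (- h) o\<^sub>L f2 e) = 0" for h
      by (rule blinfun_eqI) (simp add: g_e P_e blinfun.add_left blinfun.minus_left blinfun.minus_right
          rq S_def[symmetric])
    ultimately show ?thesis by simp
  qed
  have d\<Phi>: "(\<Phi> has_derivative (\<lambda>h. 0)) (at x)" if x: "x \<in> interior K" for x
  proof -
    obtain w where w: "w \<in> interior K" "P w e = x" using scaling_point_exists[OF e_interior x] by blast
    define T where "T = P w"
    define T' where "T' = P (- g w)"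
    have T: "T \<in> positive_automorphisms K" unfolding T_def by (rule P_positive_automorphism[OF w(1)])
    have inv: "T' (T u) = u" "T (T' u) = u" for u
      using P_neg_g_inverse[OF w(1)] by (simp_all add: T_def T'_def)
    have T': "T' y \<in> interior K" if "y \<in> interior K" for y
      unfolding T'_def using P_interior[OF that neg_g_interior[OF w(1)]] .
    have equi: "(T o\<^sub>L \<Phi> (T' y) o\<^sub>L T') = \<Phi> y" if y: "y \<in> interior K" for y
    proof (rule blinfun_eqI)
      fix u
      have inj: "a = b" if "T (P y a) = T (P y b)" for a b
        using that inv(1) bij_is_inj[OF P_bij[OF y]] by (metis injD)
      have "T (P y (T (\<Phi> (T' y) (T' u)))) = f2 (T' y) (T' u)"
        using P_invariant[OF T T'[OF y]] P_\<Phi>[OF T'[OF y]] by (simp add: inv)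
      also have "\<dots> = T (P y (\<Phi> y u))"
        using f2_inv[OF T T'[OF y], of "T' u"] P_\<Phi>[OF y] by (simp add: inv)
      finally show "(T o\<^sub>L \<Phi> (T' y) o\<^sub>L T') u = \<Phi> y u" using inj by simp
    qed
    have "(blinfun_apply T' has_derivative blinfun_apply T') (at x)"
      using bounded_linear.has_derivative[OF blinfun.bounded_linear_right has_derivative_ident] .
    moreover have "(\<Phi> has_derivative (\<lambda>h. 0)) (at (T' x))"
      using d\<Phi>_e w(2) inv(1) by (metis T_def)
    ultimately have d0: "((\<lambda>y. \<Phi> (T' y)) has_derivative (\<lambda>h. 0)) (at x)"
      by (rule has_derivative_compose)
    have "bounded_linear (\<lambda>X. T o\<^sub>L X o\<^sub>L T')" by (intro bounded_linear_intros)
    from bounded_linear.has_derivative[OF this d0]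
    have "((\<lambda>y. T o\<^sub>L \<Phi> (T' y) o\<^sub>L T') has_derivative (\<lambda>h. 0)) (at x)" by simp
    then show ?thesis
      by (rule has_derivative_transform_within_open[OF _ open_interior x]) (rule equi)
  qed
  have \<Phi>_const: "\<Phi> x = S" if x: "x \<in> interior K" for x
  proof -
    have "\<Phi> x = \<Phi> e"
      by (rule has_derivative_zero_unique[OF convex_interior[OF convex_K] _ x e_interior])
        (rule has_derivative_at_withinI[OF d\<Phi>])
    then show ?thesis by (simp add: \<Phi>_def g_e P_e S_def) (rule blinfun_eqI, simp)
  qed
  have f2_eq: "f2 x u = P x (S u)" if "x \<in> interior K" for x u
    using P_\<Phi>[OF that] \<Phi>_const[OF that] by metis
  then show "x \<in> interior K \<Longrightarrow> f2 x u = P x (f2 e u)" by (simp add: S_def)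
  have "S (P x u) = P x (S u)" if x: "x \<in> interior K" for x u
  proof -
    have "S (P x u) \<bullet> v = P x (S u) \<bullet> v" for v
      by (metis f2_eq[OF x] third_order_jet_symmetric(1)[OF f x] P_symmetric[OF x] S_sa)
    then show ?thesis by (metis vector_eq_rdot)
  qed
  then show "f2 e \<in> commutant" by (simp add: commutant_def S_def)
qed

section \<open>Orthogonal automorphisms\<close>

text \<open>An isometric automorphism preserves the norm and the distance to the complement of \<open>K\<close>.\<close>

lemma isometric_orbit_in_compact:
  assumes H: "H \<in> Aut_cone K" and iso: "\<And>x. norm (blinfun_apply H x) = norm x"
  obtains C where "compact C" "C \<subseteq> interior K" "\<And>n. (blinfun_apply H ^^ n) e \<in> C"
proof -
  obtain r where r: "r > 0" "cball e r \<subseteq> K" using e_interior mem_interior_cball by blast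
  define C where "C = {z. \<forall>b\<in>cball 0 r. z + b \<in> K} \<inter> cball 0 (norm e)"
  have "{z. \<forall>b\<in>cball 0 r. z + b \<in> K} = (\<Inter>b\<in>cball 0 r. {z. z + b \<in> K})" by blast
  moreover have "closed {z. z + b \<in> K}" for b
    using closed_vimage[OF closed_K, of "\<lambda>z. z + b"] by (simp add: vimage_def continuous_intros)
  ultimately have "closed {z. \<forall>b\<in>cball 0 r. z + b \<in> K}" by auto
  then have "compact C" unfolding C_def by (intro closed_Int_compact) auto
  moreover have "C \<subseteq> interior K"
  proof
    fix z assume z: "z \<in> C"
    have "cball z r \<subseteq> K"
    proof
      fix y assume "y \<in> cball z r"
      then have "y - z \<in> cball 0 r" by (simp add: dist_norm norm_minus_commute)
      then have "z + (y - z) \<in> K" using z unfolding C_def by blast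
      then show "y \<in> K" by simp
    qed
    then show "z \<in> interior K" using r(1) mem_interior_cball by blast
  qed
  moreover have "(blinfun_apply H ^^ n) e \<in> C" for n
  proof (induction n)
    case 0
    have "e + b \<in> K" if "b \<in> cball 0 r" for b
      using r(2) that by (auto simp: subset_iff dist_norm)
    then show ?case by (simp add: C_def)
  next
    case (Suc n)
    define z where "z = (blinfun_apply H ^^ n) e"
    have z: "z \<in> C" using Suc by (simp add: z_def)
    have "H z + b \<in> K" if b: "b \<in> cball 0 r" for b
    proof -
      obtain a where a: "b = H a" using bij_is_surj[OF Aut_coneD(1)[OF H]] by (metis surjE)
      then have "a \<in> cball 0 r" using b iso by simp
      then have "z + a \<in> K" using z unfolding C_def by blast
      from Aut_coneD(2)[OF H this] show ?thesis by (simp add: a blinfun.add_right)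
    qed
    then have "H z \<in> C" using z iso by (simp add: C_def)
    then show ?case by (simp add: z_def)
  qed
  ultimately show thesis using that by blast
qed

text \<open>Iterating the relation along the orbit of \<open>e\<close> gives \<open>S\<^sup>n = H'\<^sup>n P (H\<^sup>n e) H\<^sup>n\<close>, and \<open>P\<close> is bounded on the orbit of \<open>e\<close>.\<close>

lemma multiplier_power_bounded:
  assumes H: "H \<in> Aut_cone K" and iso: "\<And>x. norm (blinfun_apply H x) = norm x"
    and iso': "\<And>x. norm (blinfun_apply H' x) = norm x"
    and eq: "\<And>x u. x \<in> interior K \<Longrightarrow> H' (P (H x) (H u)) = P x (blinfun_apply S u)"
    and comm: "\<And>u. H (S u) = S (H u)"
  obtains C where "\<And>n. norm ((blinfun_apply S ^^ n) v) \<le> C"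
proof -
  obtain C where C: "compact C" "C \<subseteq> interior K" "\<And>n. (blinfun_apply H ^^ n) e \<in> C"
    using isometric_orbit_in_compact[OF H iso] by blast
  have "continuous_on C P"
    by (rule continuous_at_imp_continuous_on, rule ballI,
        rule has_derivative_continuous, rule third_order_jetD(4)[OF jet], erule subsetD[OF C(2)])
  then have "bounded (P ` C)" using C(1) compact_continuous_image compact_imp_bounded by blast
  then obtain M where M: "\<And>z. z \<in> C \<Longrightarrow> norm (P z) \<le> M" unfolding bounded_iff by blast
  have iso_n: "norm ((blinfun_apply H ^^ n) x) = norm x" for n x by (induction n) (simp_all add: iso)
  have iso'_n: "norm ((blinfun_apply H' ^^ n) x) = norm x" for n x by (induction n) (simp_all add: iso')
  have comm_n: "(blinfun_apply H ^^ n) (S u) = S ((blinfun_apply H ^^ n) u)" for n u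
    by (induction n) (simp_all add: comm)
  have powers: "(blinfun_apply H' ^^ n) (P ((blinfun_apply H ^^ n) e) ((blinfun_apply H ^^ n) u))
      = (blinfun_apply S ^^ n) u" for n u
  proof (induction n arbitrary: u)
    case 0 then show ?case by (simp add: P_e)
  next
    case (Suc n)
    have "(blinfun_apply H' ^^ Suc n) (P ((blinfun_apply H ^^ Suc n) e) ((blinfun_apply H ^^ Suc n) u))
        = (blinfun_apply H' ^^ n) (P ((blinfun_apply H ^^ n) e) (S ((blinfun_apply H ^^ n) u)))"
      using eq[of "(blinfun_apply H ^^ n) e"] C(2,3) by (simp add: funpow_swap1[of H'] subset_iff)
    also have "\<dots> = (blinfun_apply S ^^ n) (S u)" using Suc[of "S u"] by (simp add: comm_n)
    finally show ?case by (simp add: funpow_swap1)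
  qed
  have "norm ((blinfun_apply S ^^ n) v) \<le> M * norm v" for n
  proof -
    have "norm ((blinfun_apply S ^^ n) v) = norm (P ((blinfun_apply H ^^ n) e) ((blinfun_apply H ^^ n) v))"
      unfolding powers[symmetric] iso'_n ..
    also have "\<dots> \<le> norm (P ((blinfun_apply H ^^ n) e)) * norm ((blinfun_apply H ^^ n) v)"
      by (rule norm_blinfun)
    also have "\<dots> \<le> M * norm v" using M[OF C(3)] by (simp add: iso_n mult_right_mono)
    finally show ?thesis .
  qed
  then show thesis using that by blast
qed

lemma F_orthogonal_invariant:
  assumes H0: "H \<in> Aut_cone0 K" and orth: "orthogonal_transformation (blinfun_apply H)"
    and x: "x \<in> interior K"
  shows "F (H x) = F x"
proof -
  have H: "H \<in> Aut_cone K" using H0 connected_component_subset unfolding Aut_cone0_def by blast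
  have iso: "norm (H x) = norm x" for x using orth by (simp add: orthogonal_transformation_norm)
  obtain H' where H': "H' \<in> Aut_cone K" "\<And>x. blinfun_apply H' (H x) = x" "\<And>x. H (blinfun_apply H' x) = x"
    using Aut_cone_inverse[OF H] by metis
  have adj: "H x \<bullet> y = x \<bullet> H' y" for x y
    using orth H'(3) unfolding orthogonal_transformation_def by metis
  have iso': "norm (H' x) = norm x" for x using iso H'(3) by metis
  obtain f3 where f: "third_order_jet (interior K) (\<lambda>x. F (H x)) (\<lambda>x. H' (g (H x)))
      (\<lambda>x. H' o\<^sub>L P (H x) o\<^sub>L H) f3"
    by (rule third_order_jet_compose_linear[OF jet Aut_coneD(4)[OF H] adj])
  have hom: "F (H (t *\<^sub>R x)) = F (H x) - \<nu> * ln t" if "x \<in> interior K" "t > 0" for x t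
    using homogeneous[OF Aut_coneD(4)[OF H that(1)] that(2)] by (simp add: blinfun.scaleR_right)
  have inv: "\<exists>c. \<forall>x\<in>interior K. F (H (T x)) = F (H x) + c" if T: "T \<in> positive_automorphisms K" for T
  proof -
    obtain c where c: "\<And>x. x \<in> interior K \<Longrightarrow> F ((H o\<^sub>L T o\<^sub>L H') x) = F x + c"
      using F_positive_automorphism[OF positive_automorphism_congruence[OF self_dual T H adj]] by blast
    have "F (H (T x)) = F (H x) + c" if "x \<in> interior K" for x
      using c[OF Aut_coneD(4)[OF H that]] by (simp add: H')
    then show ?thesis by blast
  qed
  define S where "S = H' o\<^sub>L P (H e) o\<^sub>L H"
  have eq: "H' (P (H x) (H u)) = P x (S u)" if "x \<in> interior K" for x u
    using invariant_function_hessian(1)[OF f hom inv that, of u] by (simp add: S_def)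
  have SZ: "S \<in> commutant" using invariant_function_hessian(2)[OF f hom inv] by (simp add: S_def)
  have S_pos: "0 < S u \<bullet> u" if u: "u \<noteq> 0" for u
  proof -
    have "H u \<noteq> 0" using u H'(2) by (metis blinfun.zero_right)
    from positive_definiteD(2)[OF P_positive_definite[OF Aut_coneD(4)[OF H e_interior]] this]
    show ?thesis using adj by (simp add: S_def inner_commute)
  qed
  have HS: "H (S u) = S (H u)" for u
  proof (rule commutes_on_identity_component[OF commutant_self_adjoint[OF SZ]])
    show "bij (blinfun_apply A)" if "A \<in> Aut_cone K" for A using Aut_coneD(1)[OF that] .
    show "H \<in> connected_component_set (Aut_cone K) id_blinfun" using H0 by (simp add: Aut_cone0_def)
    fix A B :: "'a \<Rightarrow>\<^sub>L 'a"
    assume "A \<in> Aut_cone K" "\<And>x. B (A x) = x" "\<And>x. A (B x) = x"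
    then have Z: "B o\<^sub>L S o\<^sub>L A \<in> commutant" by (rule commutant_conjugate[OF SZ])
    show "self_adjoint (B o\<^sub>L S o\<^sub>L A) \<and> (\<forall>v. S (B (S (A v))) = B (S (A (S v))))"
      using commutant_self_adjoint[OF Z] commutant_commutative[OF SZ Z] by simp
  qed
  have S_id: "S v = v" for v
  proof -
    have "inj (blinfun_apply S)"
    proof (rule injI, rule ccontr)
      fix a b assume ab: "S a = S b" "a \<noteq> b"
      then have "S (a - b) = 0" by (simp add: blinfun.diff_right)
      then show False using S_pos[of "a - b"] ab(2) by simp
    qed
    moreover from this have "surj (blinfun_apply S)"
      using linear_injective_imp_surjective[OF blinfun_linear _ refl] by blast
    ultimately have "bij (blinfun_apply S)" by (rule bijI)
    then obtain S' where S': "\<And>x. blinfun_apply S' (S x) = x" "\<And>x. S (blinfun_apply S' x) = x"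
      using blinfun_inverse_exists by blast
    \<comment> \<open>The same relation for the inverse of \<open>H\<close>, with the inverse multiplier, bounds the negative powers of \<open>S\<close>.\<close>
    have eq': "H (P (H' y) (H' u)) = P y (S' u)" if y: "y \<in> interior K" for y u
    proof -
      have "S (H' (S' u)) = H' u" by (metis H'(2,3) HS S'(2))
      then have "H' (P y (S' u)) = P (H' y) (H' u)"
        using eq[OF Aut_coneD(4)[OF H'(1) y], of "H' (S' u)"] H'(3) by simp
      then show ?thesis by (metis H'(3))
    qed
    have comm': "H' (S' u) = S' (H' u)" for u by (metis H'(2,3) HS S')
    obtain C1 where C1: "\<And>n. norm ((blinfun_apply S ^^ n) v) \<le> C1"
      using multiplier_power_bounded[OF H iso iso' eq HS] by blast
    obtain C2 where C2: "\<And>n. norm ((blinfun_apply S' ^^ n) v) \<le> C2"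
      using multiplier_power_bounded[OF H'(1) iso' iso eq' comm'] by blast
    show ?thesis
    proof (rule power_bounded_positive_imp_identity[of id_blinfun S S'])
      show "positive_definite (id_blinfun :: 'a \<Rightarrow>\<^sub>L 'a)"
        by (simp add: positive_definite_def self_adjoint_def)
      show "norm ((blinfun_apply S ^^ n) v) \<le> max C1 C2" for n using C1[of n] by simp
      show "norm ((blinfun_apply S' ^^ n) v) \<le> max C1 C2" for n using C2[of n] by simp
    qed (use self_adjointD[OF commutant_self_adjoint[OF SZ]] S_pos S' in simp_all)
  qed
  have grad: "H' (g (H x)) = g x" if x: "x \<in> interior K" for x
  proof -
    have "- H' (g (H x)) = (H' o\<^sub>L P (H x) o\<^sub>L H) x"
      using logarithmically_homogeneous_jet(2)[OF f interior_scale hom x] by simp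
    also have "\<dots> = - g x" using eq[OF x] P_self[OF x] S_id by simp
    finally show ?thesis by simp
  qed
  have "\<exists>c. \<forall>x\<in>interior K. F (H x) - F x = c"
  proof (rule has_derivative_zero_constant[OF convex_interior[OF convex_K]], rule has_derivative_at_withinI)
    show "((\<lambda>x. F (H x) - F x) has_derivative (\<lambda>h. 0)) (at x)" if x: "x \<in> interior K" for x
      using has_derivative_diff[OF third_order_jetD(2)[OF f x] third_order_jetD(2)[OF jet x]] grad[OF x]
      by simp
  qed
  then obtain c where c: "\<And>x. x \<in> interior K \<Longrightarrow> F (H x) - F x = c" by metis
  have "c = 0"
  proof (rule ccontr)
    assume "c \<noteq> 0"
    obtain C where C: "compact C" "C \<subseteq> interior K" "\<And>n. (blinfun_apply H ^^ n) e \<in> C"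
      using isometric_orbit_in_compact[OF H iso] by blast
    have "continuous_on C F"
      by (rule continuous_at_imp_continuous_on, rule ballI,
          rule has_derivative_continuous, rule third_order_jetD(2)[OF jet], erule subsetD[OF C(2)])
    then have "bounded (F ` C)" using C(1) compact_continuous_image compact_imp_bounded by blast
    then obtain M where M: "\<And>z. z \<in> C \<Longrightarrow> \<bar>F z\<bar> \<le> M" unfolding bounded_iff by auto
    have step: "F ((blinfun_apply H ^^ n) e) = F e + real n * c" for n
    proof (induction n)
      case (Suc n)
      then show ?case using c[of "(blinfun_apply H ^^ n) e"] C(2,3) by (force simp: algebra_simps)
    qed simp
    obtain n where n: "2 * M < real n * \<bar>c\<bar>" using \<open>c \<noteq> 0\<close> reals_Archimedean3[of "\<bar>c\<bar>"] by auto
    have "real n * \<bar>c\<bar> = \<bar>F ((blinfun_apply H ^^ n) e) - F e\<bar>" by (simp add: step abs_mult)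
    also have "\<dots> \<le> 2 * M" using M[OF C(3), of n] M[OF C(3), of 0] by simp
    finally show False using n by simp
  qed
  then show ?thesis using c[OF x] by simp
qed

end

theorem theorem5p1:
  fixes K :: "'a::euclidean_space set" and F :: "'a \<Rightarrow> real" and H :: "'a \<Rightarrow>\<^sub>L 'a"
  assumes "symmetric_cone K"
    and "self_scaled_barrier K F"
    and "dual_cone K = K"
    and "\<exists>e\<in>interior K. hess F e = id"
    and "H \<in> Aut_cone0 K"
    and "orthogonal_transformation (blinfun_apply H)"
  shows "\<forall>x\<in>interior K. F (blinfun_apply H x) = F x"
proof -
  have scb: "self_concordant_barrier K F" and bij: "\<And>x. x \<in> interior K \<Longrightarrow> bij (hess F x)"
    using assms(2) by (auto simp: self_scaled_barrier_def)
  obtain \<nu> where \<nu>: "\<nu> > 0"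
    and hom: "\<And>x t. x \<in> interior K \<Longrightarrow> t > 0 \<Longrightarrow> F (t *\<^sub>R x) = F x - \<nu> * ln t"
    and hess_dual: "\<And>x w. x \<in> interior K \<Longrightarrow> w \<in> interior K \<Longrightarrow> hess F w x \<in> interior (dual_cone K)"
    and conj: "\<And>x w. x \<in> interior K \<Longrightarrow> w \<in> interior K \<Longrightarrow>
      conj_barrier K F (hess F w x) = ereal (F x - 2 * F w - \<nu>)"
    using assms(2) unfolding self_scaled_barrier_def by blast
  have C3: "C3_on (interior K) F" and cv: "convex_on (interior K) F"
    using scb by (auto simp: self_concordant_barrier_def)
  have barrier: "\<And>X z. (\<And>k::nat. X k \<in> interior K) \<Longrightarrow> z \<in> frontier K \<Longrightarrow> X \<longlonglongrightarrow> z
           \<Longrightarrow> filterlim (\<lambda>k. F (X k)) at_top sequentially"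
    using scb unfolding self_concordant_barrier_def by blast
  obtain \<kappa> where \<kappa>: "\<And>x h. x \<in> interior K \<Longrightarrow> \<bar>D1 F x h\<bar>\<^sup>2 \<le> \<kappa> * D2 F x h h"
    using scb unfolding self_concordant_barrier_def by blast
  obtain e where e: "e \<in> interior K" "hess F e = id" using assms(4) by blast
  obtain g P Q where jet: "third_order_jet (interior K) F g P Q"
    and D1: "\<And>x h. D1 F x h = g x \<bullet> h" and P: "\<And>x. hess F x = blinfun_apply (P x)"
    using C3_on_third_order_jet[OF C3 open_interior] by blast
  have D2: "D2 F x u v = P x u \<bullet> v" for x u v using hess_inner[of F x u v] P by simp
  have P_e: "P e = id_blinfun" by (rule blinfun_eqI) (metis P e(2) id_apply blinfun_apply_id_blinfun)
  \<comment> \<open>As \<open>P e\<close> is the identity, \<open>w = e\<close> in the duality relation expresses the conjugate barrier through \<open>F\<close>.\<close>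
  have dual_e: "conj_barrier K F x = ereal (F x - 2 * F e - \<nu>)" if "x \<in> interior K" for x
    using conj[OF that e(1)] by (simp add: e(2))
  have P_interior: "P w x \<in> interior K" if "x \<in> interior K" "w \<in> interior K" for x w
    using hess_dual[OF that] assms(3) P by simp
  have F_P: "F (P w x) = F x - 2 * F w + 2 * F e" if "x \<in> interior K" "w \<in> interior K" for x w
    using conj[OF that] dual_e[OF P_interior[OF that]] by (simp add: P)
  have scale: "t *\<^sub>R x \<in> interior K" if "x \<in> interior K" "t > 0" for x and t :: real
    using interior_closed_under_scaling[OF _ that(2,1)] assms(1)
    unfolding symmetric_cone_def regular_cone_def cone_def by simp
  have P_nonneg: "0 \<le> P x h \<bullet> h" if x: "x \<in> interior K" for x h
  proof -
    note h = logarithmically_homogeneous_jet[OF jet scale hom x]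
    \<comment> \<open>The bound on the gradient makes the Hessian nonnegative once \<open>\<kappa> > 0\<close>; the direction \<open>h = x\<close> shows that.\<close>
    have "0 < (g x \<bullet> x)\<^sup>2" using h(1) \<nu> by simp
    also have "\<dots> \<le> \<kappa> * (P x x \<bullet> x)" using \<kappa>[OF x, of x] by (simp add: D1 D2)
    also have "\<dots> = \<kappa> * \<nu>" using h(1,2) by simp
    finally have "\<kappa> > 0" using \<nu> by (simp add: zero_less_mult_iff)
    moreover have "0 \<le> \<kappa> * (P x h \<bullet> h)"
      using \<kappa>[OF x, of h] by (simp add: D2) (meson order_trans zero_le_power2)
    ultimately show ?thesis by (simp add: zero_le_mult_iff)
  qed
  interpret self_scaled_jet K F g P Q \<nu> e
    by unfold_locales
      (use assms(3) jet e(1) P_e hom cv barrier P_nonneg bij P P_interior F_P in auto)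
  show ?thesis using F_orthogonal_invariant[OF assms(5,6)] by blast
qed

end
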